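(* Let $k\ge 2$ and let $a_1\ge a_2\ge\cdots\ge a_k\ge 1$ be integers with $a_1\ge 2$, and put $t=\sum_{i=1}^k a_i$. Let $G$ be an $F_{a_1,\dots,a_k}$-free graph of order $n\ge 8t^2-12t+9$. Then $q(G)\le q(S_{n,t})$, with equality if and only if $G\cong S_{n,t}$.
   Context: All graphs are finite, simple and undirected. For a graph $G$, $Q(G)=D(G)+A(G)$ is its signless Laplacian matrix ($D(G)$ the diagonal degree matrix, $A(G)$ the adjacency matrix), and $q(G)$ denotes the largest eigenvalue of $Q(G)$. $F_{a_1,\dots,a_k}$ is the graph consisting of $k$ cycles of odd lengths $2a_1+1,\dots,2a_k+1$ which pairwise intersect in exactly one common vertex (shared by all of them). A graph is $H$-free if it contains no subgraph isomorphic to $H$. $S_{n,t}$ denotes the join $K_t\nabla\overline{K}_{n-t}$, i.e. a clique on $t$ vertices with every vertex joined to each vertex of an independent set of $n-t$ vertices. *)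

theory Defs
  imports Complex_Main
begin

definition simple_graph :: "'a set \<Rightarrow> ('a \<Rightarrow> 'a \<Rightarrow> bool) \<Rightarrow> bool" where
  "simple_graph V E \<longleftrightarrow> finite V \<and>
     (\<forall>u v. E u v \<longrightarrow> u \<in> V \<and> v \<in> V \<and> u \<noteq> v \<and> E v u)"

definition degree :: "'a set \<Rightarrow> ('a \<Rightarrow> 'a \<Rightarrow> bool) \<Rightarrow> 'a \<Rightarrow> nat" where
  "degree V E v = card {u \<in> V. E v u}"

definition signless_lap_apply :: "'a set \<Rightarrow> ('a \<Rightarrow> 'a \<Rightarrow> bool) \<Rightarrow> ('a \<Rightarrow> real) \<Rightarrow> 'a \<Rightarrow> real" where
  "signless_lap_apply V E x v = real (degree V E v) * x v + (\<Sum>u\<in>V. (if E v u then x u else 0))"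

definition Q_eigenvalue :: "'a set \<Rightarrow> ('a \<Rightarrow> 'a \<Rightarrow> bool) \<Rightarrow> real \<Rightarrow> bool" where
  "Q_eigenvalue V E mu \<longleftrightarrow> (\<exists>x. (\<exists>v\<in>V. x v \<noteq> 0) \<and>
       (\<forall>v\<in>V. signless_lap_apply V E x v = mu * x v))"

definition q_index :: "'a set \<Rightarrow> ('a \<Rightarrow> 'a \<Rightarrow> bool) \<Rightarrow> real" where
  "q_index V E = Max {mu. Q_eigenvalue V E mu}"

definition contains_subgraph ::
  "'a set \<Rightarrow> ('a \<Rightarrow> 'a \<Rightarrow> bool) \<Rightarrow> 'b set \<Rightarrow> ('b \<Rightarrow> 'b \<Rightarrow> bool) \<Rightarrow> bool" where
  "contains_subgraph V E VH EH \<longleftrightarrow> (\<exists>f. inj_on f VH \<and> f ` VH \<subseteq> V \<and>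
      (\<forall>x\<in>VH. \<forall>y\<in>VH. EH x y \<longrightarrow> E (f x) (f y)))"

definition graph_iso ::
  "'a set \<Rightarrow> ('a \<Rightarrow> 'a \<Rightarrow> bool) \<Rightarrow> 'b set \<Rightarrow> ('b \<Rightarrow> 'b \<Rightarrow> bool) \<Rightarrow> bool" where
  "graph_iso V E V' E' \<longleftrightarrow> (\<exists>f. bij_betw f V V' \<and>
      (\<forall>x\<in>V. \<forall>y\<in>V. E x y \<longleftrightarrow> E' (f x) (f y)))"

text \<open>The friendship-type graph F_{a_1,...,a_k}, with a = [a_1,...,a_k] (0-indexed):
  centre None; cycle i consists of None, Some(i,1), ..., Some(i,2 a_i), None,
  so it has length 2 a_i + 1.\<close>
definition F_verts :: "nat list \<Rightarrow> (nat \<times> nat) option set" where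
  "F_verts a = {None} \<union> {Some (i, j) | i j. i < length a \<and> 1 \<le> j \<and> j \<le> 2 * a ! i}"

definition F_edge0 :: "nat list \<Rightarrow> (nat \<times> nat) option \<Rightarrow> (nat \<times> nat) option \<Rightarrow> bool" where
  "F_edge0 a x y \<longleftrightarrow> (\<exists>i < length a.
      (x = None \<and> y = Some (i, 1)) \<or>
      (x = None \<and> y = Some (i, 2 * a ! i)) \<or>
      (\<exists>j. 1 \<le> j \<and> j < 2 * a ! i \<and> x = Some (i, j) \<and> y = Some (i, j + 1)))"

definition F_edge :: "nat list \<Rightarrow> (nat \<times> nat) option \<Rightarrow> (nat \<times> nat) option \<Rightarrow> bool" where
  "F_edge a x y \<longleftrightarrow> F_edge0 a x y \<or> F_edge0 a y x"

text \<open>S_{n,t} = K_t join complement of K_{n-t} on vertices {0..<n}; vertices < t form the clique.\<close>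
definition S_edge :: "nat \<Rightarrow> nat \<Rightarrow> nat \<Rightarrow> bool" where
  "S_edge t u v \<longleftrightarrow> u \<noteq> v \<and> (u < t \<or> v < t)"

end

theory Submission
  imports Defs "HOL-Library.Multiset" "Jordan_Normal_Form.Char_Poly"
begin

text \<open>Let \<open>q\<close> be the index of \<open>S\<^sub>n\<^sub>,\<^sub>t\<close>, the larger root of
  \<open>q\<^sup>2 - (n + 2t - 2) q + 2t(t - 1)\<close>, and suppose that the index \<open>\<mu>\<close> of \<open>G\<close> is at
  least \<open>q\<close>. Some vertex \<open>u\<close> then satisfies \<open>d(u) + m(u) \<ge> q\<close>, where \<open>m(u)\<close> is the average
  degree of its neighbours. Since \<open>G[N(u)]\<close> has no path on \<open>2t\<close> vertices, the Erdos-Gallai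
  bound makes this inequality almost tight, so \<open>G[N(u)]\<close> has nearly \<open>(t - 1) d(u)\<close> edges and
  nearly all edges between \<open>N(u)\<close> and the remaining vertices are present. A remaining vertex could
  thus serve inside the longest cycle (of length at least 5), and Erdos-Gallai would produce the
  forbidden graph; hence \<open>u\<close> is adjacent to all other vertices. The eigenvector equations,
  summed over \<open>G - u\<close>, now force \<open>t - 1\<close> further vertices of almost full degree. Let \<open>L\<close>
  consist of \<open>u\<close> and these hubs. A vertex outside \<open>L\<close> with a neighbour outside \<open>L\<close> is adjacent
  to no hub, as otherwise a path on \<open>2t\<close> vertices alternating between hubs and common neighbours
  appears. This suffices for the Perron vector of \<open>S\<^sub>n\<^sub>,\<^sub>t\<close>, constant on \<open>L\<close> and on
  its complement, to satisfy \<open>Q y \<le> q y\<close> on \<open>G\<close>. So \<open>\<mu> = q\<close>, and equality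
  throughout identifies \<open>G\<close> with \<open>S\<^sub>n\<^sub>,\<^sub>t\<close>.\<close>

section \<open>Paths and the Erdos-Gallai bound\<close>

text \<open>Paths are lists of vertices, so \<open>length\<close> counts vertices and not
  edges.\<close>

definition gpath :: "('a \<Rightarrow> 'a \<Rightarrow> bool) \<Rightarrow> 'a set \<Rightarrow> 'a list \<Rightarrow> bool" where
  "gpath E A p \<longleftrightarrow> distinct p \<and> set p \<subseteq> A \<and> successively E p"

text \<open>No vertex set is fixed: the same relation is restricted to many subsets, and
  \<open>S_edge t\<close> relates all naturals, not only those below \<open>n\<close>.\<close>

locale sym_irrefl =
  fixes E :: "'a \<Rightarrow> 'a \<Rightarrow> bool"
  assumes sym: "E u v \<Longrightarrow> E v u" and irrefl: "\<not> E u u"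
begin

section \<open>Degree sums and double counting\<close>

lemma edge_count_swap:
  assumes "finite A" "finite B"
  shows "(\<Sum>v\<in>A. Defs.degree B E v) = (\<Sum>v\<in>B. Defs.degree A E v)"
proof -
  have c: "Defs.degree C E v = (\<Sum>w\<in>C. if E v w then 1 else 0)" if "finite C" for C v
    unfolding Defs.degree_def using that by (simp add: sum.If_cases Int_def)
  have "(\<Sum>v\<in>A. Defs.degree B E v) = (\<Sum>v\<in>A. \<Sum>w\<in>B. if E v w then 1 else 0)"
    using c assms by simp
  also have "\<dots> = (\<Sum>w\<in>B. \<Sum>v\<in>A. if E w v then 1 else 0)"
    by (subst sum.swap) (intro sum.cong refl, use sym in auto)
  finally show ?thesis using c assms by simp
qed

lemma degree_Un:
  assumes "finite A" "finite B" "A \<inter> B = {}"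
  shows "Defs.degree (A \<union> B) E v = Defs.degree A E v + Defs.degree B E v"
proof -
  have "{u \<in> A \<union> B. E v u} = {u \<in> A. E v u} \<union> {u \<in> B. E v u}" by auto
  then show ?thesis unfolding Defs.degree_def
    using assms by (simp add: card_Un_disjoint disjoint_iff)
qed

lemma degree_sum_Un:
  assumes "finite A" "finite B" "A \<inter> B = {}"
  shows "(\<Sum>v\<in>A \<union> B. Defs.degree (A \<union> B) E v) =
    (\<Sum>v\<in>A. Defs.degree A E v) + (\<Sum>v\<in>B. Defs.degree B E v) + 2 * (\<Sum>v\<in>B. Defs.degree A E v)"
proof -
  have "(\<Sum>v\<in>A \<union> B. Defs.degree (A \<union> B) E v) =
    (\<Sum>v\<in>A. Defs.degree (A \<union> B) E v) + (\<Sum>v\<in>B. Defs.degree (A \<union> B) E v)"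
    using assms by (simp add: sum.union_disjoint)
  then show ?thesis
    using edge_count_swap[OF assms(1,2)] by (simp add: degree_Un[OF assms] sum.distrib)
qed

lemma degree_le_card: "finite A \<Longrightarrow> Defs.degree A E v \<le> card A"
  unfolding Defs.degree_def by (rule card_mono) auto

lemma degree_less_card: 
  assumes "finite A" "v \<in> A" shows "Defs.degree A E v \<le> card A - 1"
proof -
  have "Defs.degree A E v \<le> card (A - {v})"
    unfolding Defs.degree_def by (rule card_mono) (use assms irrefl in auto)
  then show ?thesis using assms by simp
qed

lemma successively_rev_sym: "successively E (rev p) \<longleftrightarrow> successively E p"
proof -
  have "(\<lambda>x y. E y x) = E" using sym by blast
  then show ?thesis by (simp only: List.successively_rev)
qed

text \<open>The two crossing chords turn \<open>p\<close> into a cycle on the same vertices. Cutting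
  that cycle at \<open>v\<close> gives a path ending in \<open>v\<close>, which a neighbour
  \<open>w\<close> off \<open>p\<close> would lengthen.\<close>

lemma longest_path_crossing_closed:
  assumes p: "gpath E A p" and max: "\<And>q. gpath E A q \<Longrightarrow> length q \<le> length p"
    and i: "Suc i < length p" "E (p ! 0) (p ! Suc i)" "E (p ! i) (p ! (length p - 1))"
    and v: "v \<in> set p" and w: "w \<in> A - set p"
  shows "\<not> E v w"
proof
  assume vw: "E v w"
  \<comment> \<open>The cycle runs from \<open>p ! 0\<close> up to \<open>p ! i\<close>, jumps to
    the last vertex, descends to \<open>p ! Suc i\<close> and closes at
    \<open>p ! 0\<close>.\<close>
  define c where "c = take (Suc i) p @ rev (drop (Suc i) p)"
  have c: "mset c = mset p" unfolding c_def
    by (metis append_take_drop_id mset_append mset_rev)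
  then have sc: "set c = set p" and dc: "distinct c" and lc: "length c = length p"
    using p by (auto simp: gpath_def dest: mset_eq_setD mset_eq_imp_distinct_iff mset_eq_length)
  have ne: "take (Suc i) p \<noteq> []" "drop (Suc i) p \<noteq> []" using i by auto
  have p': "successively E (take (Suc i) p @ drop (Suc i) p)" using p by (simp add: gpath_def)
  have "last (take (Suc i) p) = p ! i" using i by (simp add: take_Suc_conv_app_nth)
  moreover have "hd (rev (drop (Suc i) p)) = p ! (length p - 1)"
    using i last_conv_nth[of p] by (force simp: hd_rev)
  ultimately have s1: "successively E c"
    using p' i(3) unfolding c_def successively_append_iff successively_rev_sym by presburger
  have s2: "E (last c) (hd c)"
  proof -
    have "last c = p ! Suc i" using i ne by (simp add: c_def last_rev hd_drop_conv_nth)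
    moreover have "hd c = p ! 0" using i by (cases p) (auto simp: c_def)
    ultimately show ?thesis using i sym by simp
  qed
  obtain xs ys where xy: "c = xs @ v # ys" using v sc by (metis split_list)
  define r where "r = ys @ (xs @ [v])"
  have r1: "successively E r"
  proof -
    obtain us where us: "us = xs @ [v]" "us \<noteq> []" "c = us @ ys" using xy by simp
    have "successively E us" "successively E ys"
      using s1 unfolding us(3) successively_append_iff by blast+
    moreover have "E (last ys) (hd us)" if "ys \<noteq> []" using s2 that us(2) unfolding us(3) by simp
    ultimately have "successively E (ys @ us)" unfolding successively_append_iff by blast
    then show ?thesis using us by (simp add: r_def)
  qed
  have r2: "mset r = mset c" by (simp add: r_def xy)
  then have r3: "set r = set p" "distinct r" "length r = length p"
    using sc dc lc by (auto dest: mset_eq_setD mset_eq_imp_distinct_iff mset_eq_length)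
  have "last r = v" by (simp add: r_def)
  then have "successively E (r @ [w])"
    using r1 vw by (simp only: successively_append_iff) simp
  then have "gpath E A (r @ [w])"
    using r3(1,2) p w unfolding gpath_def by simp
  from max[OF this] r3 show False by simp
qed

text \<open>If the end points of a longest path have neighbours in crossing positions, the path closes to
  a cycle spanning a whole component, which can be deleted; otherwise one end point has few
  neighbours and can be deleted.\<close>
lemma erdos_gallai:
  assumes "finite A" "\<nexists>p. gpath E A p \<and> length p = m" "m \<ge> 2"
  shows "(\<Sum>v\<in>A. Defs.degree A E v) \<le> (m - 2) * card A"
  using assms(1,2)
proof (induction A rule: finite_psubset_induct)
  case (psubset A)
  note fin = \<open>finite A\<close>
  show ?case
  proof (cases "A = {}")
    case False
    then obtain x where "x \<in> A" by auto
    then have g1: "gpath E A [x]" by (simp add: gpath_def)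
    have len: "length p < m" if "gpath E A p" for p
    proof (rule ccontr)
      assume "\<not> length p < m"
      then have "gpath E A (take m p) \<and> length (take m p) = m"
        using that unfolding gpath_def
        by (metis append_take_drop_id distinct_take dual_order.trans length_take linorder_not_less min.absorb2
            set_take_subset successively_append_iff)
      then show False using psubset.prems by blast
    qed
    obtain p where p: "gpath E A p" and max: "\<And>q. gpath E A q \<Longrightarrow> length q \<le> length p"
      using ex_has_greatest_nat[of "gpath E A" "[x]" length m] g1 len by (meson less_imp_le)
    define l where "l = length p"
    have l1: "l \<ge> 1" using max[OF g1] by (simp add: l_def)
    have lm: "l \<le> m - 1" using len[OF p] by (simp add: l_def)
    have dp: "distinct p" and sp: "set p \<subseteq> A" and pp: "successively E p" using p by (auto simp: gpath_def)
    have IH: "(\<Sum>v\<in>B. Defs.degree B E v) \<le> (m - 2) * card B" if "B \<subset> A" for B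
      using psubset.IH[OF that] psubset.prems that unfolding gpath_def by (meson psubset_imp_subset subset_trans)
    show ?thesis
    proof (cases "\<exists>i. Suc i < l \<and> E (p ! 0) (p ! Suc i) \<and> E (p ! i) (p ! (l - 1))")
      case True
      then obtain i where i: "Suc i < l" "E (p ! 0) (p ! Suc i)" "E (p ! i) (p ! (l - 1))" by blast
      have cl: "\<not> E v w" if "v \<in> set p" "w \<in> A - set p" for v w
        using longest_path_crossing_closed[OF p max] i that unfolding l_def by blast
      let ?B = "A - set p"
      have A: "A = set p \<union> ?B" using sp by auto
      have "(\<Sum>v\<in>A. Defs.degree A E v) = (\<Sum>v\<in>set p. Defs.degree (set p) E v) + (\<Sum>v\<in>?B. Defs.degree ?B E v)
          + 2 * (\<Sum>v\<in>?B. Defs.degree (set p) E v)"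
        using degree_sum_Un[of "set p" ?B] fin A by simp
      also have "(\<Sum>v\<in>?B. Defs.degree (set p) E v) = 0"
      proof -
        have "{u \<in> set p. E v u} = {}" if "v \<in> ?B" for v using cl[OF _ that] sym[of v] by blast
        then show ?thesis unfolding Defs.degree_def by (intro sum.neutral) auto
      qed
      also have "(\<Sum>v\<in>set p. Defs.degree (set p) E v) \<le> (\<Sum>v\<in>set p. m - 2)"
      proof (rule sum_mono)
        fix v assume "v \<in> set p"
        then have "Defs.degree (set p) E v \<le> card (set p) - 1" by (intro degree_less_card) auto
        then show "Defs.degree (set p) E v \<le> m - 2" using lm distinct_card[OF dp] by (simp add: l_def)
      qed
      also have "(\<Sum>v\<in>?B. Defs.degree ?B E v) \<le> (m - 2) * card ?B"
      proof (rule IH)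
        have "p ! 0 \<in> set p" using l1 by (intro nth_mem) (simp add: l_def Suc_le_eq)
        then show "?B \<subset> A" using sp by blast
      qed
      finally have "(\<Sum>v\<in>A. Defs.degree A E v) \<le> (m - 2) * (card (set p) + card ?B)"
        by (simp add: algebra_simps)
      moreover have "card (set p) + card ?B = card A"
        using fin sp by (metis card_Diff_subset card_mono finite_set le_add_diff_inverse)
      ultimately show ?thesis by simp
    next
      case False
      have end_nb: "w \<in> set p" if "w \<in> A" "E (p ! 0) w \<or> E (p ! (l - 1)) w" for w
      proof (rule ccontr)
        assume w: "w \<notin> set p"
        have ne: "p \<noteq> []" using l1 by (auto simp: l_def)
        have "gpath E A (w # p) \<or> gpath E A (p @ [w])"
          using that w p ne sym unfolding gpath_def l_def
          by (auto simp: successively_append_iff successively_Cons hd_conv_nth last_conv_nth)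
        then show False using max by fastforce
      qed
      \<comment> \<open>\<open>I\<close> and \<open>J\<close> record the neighbours of the two ends
        by position, those of the first end shifted down by one. A common position would be a
        crossing pair, so the two degrees add up to at most \<open>l - 1\<close>.\<close>
      define I where "I = {i. Suc i < l \<and> E (p ! 0) (p ! Suc i)}"
      define J where "J = {i. Suc i < l \<and> E (p ! i) (p ! (l - 1))}"
      have "I \<inter> J = {}" using False by (auto simp: I_def J_def)
      moreover have "I \<union> J \<subseteq> {..<l - 1}" by (auto simp: I_def J_def)
      ultimately have IJ: "card I + card J \<le> l - 1"
        by (metis card_Un_disjoint card_lessThan card_mono finite_Un finite_lessThan finite_subset)
      have finIJ: "finite I" "finite J"
        by (auto simp: I_def J_def intro: finite_subset[of _ "{..<l}"])
      have "{u \<in> A. E (p ! 0) u} \<subseteq> (\<lambda>i. p ! Suc i) ` I"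
      proof
        fix w assume "w \<in> {u \<in> A. E (p ! 0) u}"
        then have w: "w \<in> A" "E (p ! 0) w" by simp_all
        then have "w \<in> set p" using end_nb by blast
        then obtain j where j: "j < l" "p ! j = w" unfolding in_set_conv_nth l_def by blast
        have j0: "j \<noteq> 0" using w(2) j(2) irrefl by metis
        then obtain i where i: "j = Suc i" by (cases j) simp_all
        have "i \<in> I" using j w i unfolding I_def by simp
        moreover have "w = p ! Suc i" using j i by simp
        ultimately show "w \<in> (\<lambda>i. p ! Suc i) ` I" by (rule rev_image_eqI)
      qed
      then have d0: "Defs.degree A E (p ! 0) \<le> card I"
        unfolding Defs.degree_def by (rule surj_card_le[OF finIJ(1)])
      have "{u \<in> A. E (p ! (l - 1)) u} \<subseteq> (\<lambda>i. p ! i) ` J"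
      proof
        fix w assume "w \<in> {u \<in> A. E (p ! (l - 1)) u}"
        then have w: "w \<in> A" "E (p ! (l - 1)) w" by simp_all
        then have "w \<in> set p" using end_nb by blast
        then obtain j where j: "j < l" "p ! j = w" unfolding in_set_conv_nth l_def by blast
        have j0: "j \<noteq> (l - 1)" using w(2) j(2) irrefl by metis
        have "Suc j < l" using j(1) j0 by linarith
        moreover have "E (p ! j) (p ! (l - 1))" using sym[OF w(2)] j(2) by simp
        ultimately have "j \<in> J" unfolding J_def by simp
        moreover have "w = p ! j" using j by simp
        ultimately show "w \<in> (\<lambda>i. p ! i) ` J" by (rule rev_image_eqI)
      qed
      then have d1: "Defs.degree A E (p ! (l - 1)) \<le> card J"
        unfolding Defs.degree_def by (rule surj_card_le[OF finIJ(2)])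
      have "p ! 0 \<in> set p" "p ! (l - 1) \<in> set p"
        using l1 by (intro nth_mem; simp add: l_def Suc_le_eq)+
      then have ends: "p ! 0 \<in> A" "p ! (l - 1) \<in> A" using sp by blast+
      \<comment> \<open>Since \<open>l - 1 \<le> m - 2\<close>, one end has degree at most half of
        \<open>m - 2\<close>; deleting it lowers the degree sum by twice its degree.\<close>
      obtain v where v: "v \<in> A" "2 * Defs.degree A E v \<le> m - 2"
      proof (cases "2 * Defs.degree A E (p ! 0) \<le> m - 2")
        case True
        then show ?thesis using that ends(1) by blast
      next
        case False
        then have "2 * Defs.degree A E (p ! (l - 1)) \<le> m - 2" using d0 d1 IJ lm by linarith
        then show ?thesis using that ends(2) by blast
      qed
      let ?B = "A - {v}"
      have A: "A = ?B \<union> {v}" using v by auto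
      have z: "Defs.degree {v} E v = 0" unfolding Defs.degree_def using irrefl by auto
      have "Defs.degree A E v = Defs.degree ?B E v"
        using degree_Un[of ?B "{v}" v] A fin z by simp
      moreover have "(\<Sum>v\<in>A. Defs.degree A E v) = (\<Sum>v\<in>?B. Defs.degree ?B E v) + 2 * Defs.degree ?B E v"
        using degree_sum_Un[of ?B "{v}"] A fin z by simp
      moreover have "(\<Sum>v\<in>?B. Defs.degree ?B E v) \<le> (m - 2) * card ?B" by (rule IH) (use v in auto)
      ultimately have "(\<Sum>v\<in>A. Defs.degree A E v) \<le> (m - 2) * card ?B + (m - 2)" using v(2) by linarith
      also have "\<dots> = (m - 2) * Suc (card ?B)" by simp
      also have "Suc (card ?B) = card A" using v fin by (metis card_Suc_Diff1)
      finally show ?thesis .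
    qed
  qed simp
qed

end

section \<open>Cycles through a common vertex\<close>

lemma distinct_concat_nth_eq:
  assumes "distinct (concat ps)" "i < length ps" "i' < length ps" "j < length (ps ! i)" "j' < length (ps ! i')"
    and "ps ! i ! j = ps ! i' ! j'"
  shows "i = i' \<and> j = j'"
  using assms
proof (induction ps arbitrary: i i')
  case (Cons p ps)
  have in_rest: "ps ! k ! l \<in> set (concat ps)" if "k < length ps" "l < length (ps ! k)" for k l
    using nth_mem[OF that(1)] nth_mem[OF that(2)] by auto
  show ?case
  proof (cases i; cases i')
    fix k k' assume "i = Suc k" "i' = Suc k'"
    then show ?thesis using Cons.IH[of k k'] Cons.prems by simp
  next
    fix k' assume *: "i = 0" "i' = Suc k'"
    then have "p ! j \<in> set p" "p ! j \<in> set (concat ps)"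
      using Cons.prems in_rest[of k' j'] nth_mem[of j p] by auto
    then show ?thesis using Cons.prems(1) by auto
  next
    fix k assume *: "i = Suc k" "i' = 0"
    then have "p ! j' \<in> set p" "p ! j' \<in> set (concat ps)"
      using Cons.prems in_rest[of k j] nth_mem[of j' p] by auto
    then show ?thesis using Cons.prems(1) by auto
  next
    assume *: "i = 0" "i' = 0"
    then have "p ! j = p ! j'" "j < length p" "j' < length p" using Cons.prems by simp_all
    then show ?thesis using * Cons.prems(1) by (simp add: nth_eq_iff_index_eq)
  qed
qed simp

text \<open>Used to sort petals, which may be found in any order, so that their lengths follow the
  order of the list \<open>a\<close>.\<close>

lemma reorder_by_image:
  assumes "mset cs = mset (map f xs)"
  shows "\<exists>ys. mset ys = mset xs \<and> map f ys = cs"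
  using assms
proof (induction cs arbitrary: xs)
  case (Cons c cs)
  have "c \<in> set (map f xs)" using mset_eq_setD[OF Cons.prems] by auto
  then obtain x where x: "x \<in> set xs" "c = f x" by auto
  then obtain us vs where xs: "xs = us @ x # vs" by (meson split_list)
  have "mset cs = mset (map f (us @ vs))" using Cons.prems by (simp add: xs x(2))
  then obtain ys where "mset ys = mset (us @ vs)" "map f ys = cs" using Cons.IH by blast
  then have "mset (x # ys) = mset xs \<and> map f (x # ys) = c # cs" by (simp add: xs x(2))
  then show ?case by (rule exI)
qed simp

text \<open>The paths left over from the cycles after removing the centre \<open>u\<close>; the lengths are compared as
  multisets so that the paths may be found in any order.\<close>
definition petals :: "('a \<Rightarrow> 'a \<Rightarrow> bool) \<Rightarrow> 'a set \<Rightarrow> 'a \<Rightarrow> nat list \<Rightarrow> 'a list list \<Rightarrow> bool" where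
  "petals E V u a ps \<longleftrightarrow> mset (map length ps) = mset (map ((*) 2) a) \<and> distinct (concat ps) \<and>
     set (concat ps) \<subseteq> V - {u} \<and> (\<forall>p\<in>set ps. successively E p \<and> E u (hd p) \<and> E u (last p))"

context sym_irrefl
begin

lemma petals_contain_F:
  assumes "petals E V u a ps" and u: "u \<in> V" and a1: "\<forall>c\<in>set a. 1 \<le> c"
  shows "contains_subgraph V E (F_verts a) (F_edge a)"
proof -
  obtain qs where qs: "mset qs = mset ps" "map length qs = map ((*) 2) a"
    using assms(1) reorder_by_image[of "map ((*) 2) a" length ps] unfolding petals_def by metis
  have "mset (concat qs) = mset (concat ps)"
    unfolding mset_concat sum_mset_sum_list[symmetric] mset_map qs(1) ..
  then have dc: "distinct (concat qs)" and sc: "set (concat qs) \<subseteq> V - {u}"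
    using assms(1) unfolding petals_def by (metis mset_eq_imp_distinct_iff, metis mset_eq_setD)
  have sq: "successively E p \<and> E u (hd p) \<and> E u (last p)" if "p \<in> set qs" for p
    using that assms(1) mset_eq_setD[OF qs(1)] unfolding petals_def by blast
  have lq: "length qs = length a" using qs(2) by (metis length_map)
  have lqi: "length (qs ! i) = 2 * a ! i" if "i < length a" for i
    using qs(2) lq that by (metis nth_map)
  have apos: "a ! i \<ge> 1" if "i < length a" for i using a1 that by simp
  \<comment> \<open>The vertices of cycle \<open>i\<close> are numbered from 1 in
    \<open>F_verts\<close> but list positions start at 0; hence \<open>j - 1\<close>.\<close>
  define f where "f = (\<lambda>x. case x of None \<Rightarrow> u | Some (i, j) \<Rightarrow> qs ! i ! (j - 1))"
  have f: "f None = u" "\<And>i j. f (Some (i, j)) = qs ! i ! (j - 1)" by (simp_all add: f_def)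
  have fS: "f (Some q) \<in> V - {u}" if "Some q \<in> F_verts a" for q
  proof -
    obtain i j where q: "q = (i, j)" and ij: "i < length a" "1 \<le> j" "j \<le> 2 * a ! i"
      using \<open>Some q \<in> F_verts a\<close> by (auto simp: F_verts_def)
    have "qs ! i ! (j - 1) \<in> set (qs ! i)" using ij lqi[OF ij(1)] by (intro nth_mem) linarith
    moreover have "qs ! i \<in> set qs" using ij(1) lq by simp
    ultimately show ?thesis using sc unfolding q f set_concat by blast
  qed
  have "inj_on f (F_verts a)"
  proof (rule inj_onI)
    fix x y assume x: "x \<in> F_verts a" and y: "y \<in> F_verts a" and eq: "f x = f y"
    show "x = y"
    proof (cases x; cases y)
      fix p q assume pq: "x = Some p" "y = Some q"
      obtain i j i' j' where ij: "p = (i, j)" "q = (i', j')" by (metis surj_pair)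
      then have b: "i < length a" "1 \<le> j" "j \<le> 2 * a ! i" "i' < length a" "1 \<le> j'" "j' \<le> 2 * a ! i'"
        using x y pq by (auto simp: F_verts_def)
      have "i = i' \<and> j - 1 = j' - 1"
      proof (rule distinct_concat_nth_eq[OF dc])
        show "i < length qs" "i' < length qs" using b lq by simp_all
        show "j - 1 < length (qs ! i)" "j' - 1 < length (qs ! i')" 
          using b(2,3,5,6) unfolding lqi[OF b(1)] lqi[OF b(4)] by linarith+
        show "qs ! i ! (j - 1) = qs ! i' ! (j' - 1)" using eq unfolding pq ij f .
      qed
      then show ?thesis using b(2,5) unfolding pq ij by auto
    next
      fix q assume "x = None" "y = Some q"
      then show ?thesis using fS[of q] eq y f(1) by simp
    next
      fix q assume "x = Some q" "y = None"
      then show ?thesis using fS[of q] eq x f(1) by simp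
    qed simp
  qed
  moreover have "f ` F_verts a \<subseteq> V"
  proof
    fix y assume "y \<in> f ` F_verts a"
    then obtain x where x: "x \<in> F_verts a" "y = f x" by blast
    show "y \<in> V"
    proof (cases x)
      case (Some q)
      then show ?thesis using fS[of q] x by simp
    next
      case None
      then show ?thesis using x u f(1) by simp
    qed
  qed
  moreover have e0: "E (f x) (f y)" if "F_edge0 a x y" for x y
  proof -
    from that obtain i where i: "i < length a" and c:
      "(x = None \<and> y = Some (i, 1)) \<or> (x = None \<and> y = Some (i, 2 * a ! i)) \<or>
      (\<exists>j. 1 \<le> j \<and> j < 2 * a ! i \<and> x = Some (i, j) \<and> y = Some (i, j + 1))"
      unfolding F_edge0_def by blast
    have ne: "qs ! i \<noteq> []" using lqi[OF i] apos[OF i] by auto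
    have s: "successively E (qs ! i)" "E u (hd (qs ! i))" "E u (last (qs ! i))"
      using sq[of "qs ! i"] i lq by simp_all
    from c show ?thesis
    proof (elim disjE exE conjE)
      assume "x = None" "y = Some (i, 1)"
      then show ?thesis using s ne by (simp add: f hd_conv_nth)
    next
      assume "x = None" "y = Some (i, 2 * a ! i)"
      then show ?thesis using s ne lqi[OF i] by (simp add: f last_conv_nth)
    next
      fix j assume "1 \<le> j" "j < 2 * a ! i" "x = Some (i, j)" "y = Some (i, j + 1)"
      moreover from this have "Suc (j - 1) < length (qs ! i)" unfolding lqi[OF i] by linarith
      ultimately show ?thesis using s(1) unfolding successively_conv_nth
        by (metis f(2) Suc_diff_1 add_diff_cancel_right' One_nat_def Suc_le_eq)
    qed
  qed
  moreover have "E (f x) (f y)" if "F_edge a x y" for x y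
    using that e0 sym unfolding F_edge_def by blast
  ultimately show ?thesis unfolding contains_subgraph_def by blast
qed

section \<open>Cutting petals out of a path\<close>

lemma petals_Cons:
  assumes "petals E (V - set p) u a ps" "length p = 2 * b" "distinct p" "set p \<subseteq> V - {u}"
    "successively E p" "E u (hd p)" "E u (last p)"
  shows "petals E V u (b # a) (p # ps)"
proof -
  have "mset (map length (p # ps)) = mset (map ((*) 2) (b # a))"
    using assms(1,2) by (simp add: petals_def)
  moreover have "distinct (concat (p # ps))" "set (concat (p # ps)) \<subseteq> V - {u}"
    using assms(1,3,4) unfolding petals_def by auto
  ultimately show ?thesis using assms(1,5-7) unfolding petals_def by simp
qed

lemma petals_mono: "petals E V u a ps \<Longrightarrow> V \<subseteq> V' \<Longrightarrow> petals E V' u a ps"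
  unfolding petals_def by blast

text \<open>Consecutive segments with \<open>2 * c\<close> vertices are cut off the path; since all
  its vertices are neighbours of \<open>u\<close>, each segment closes through \<open>u\<close> to
  an odd cycle. Restricting to \<open>V \<inter> set p\<close> keeps the segments disjoint in the
  induction.\<close>

lemma path_petals:
  assumes "gpath E V p" "\<forall>v\<in>set p. E u v" "2 * sum_list a \<le> length p" "\<forall>c\<in>set a. 1 \<le> c"
  shows "\<exists>ps. petals E (V \<inter> set p) u a ps"
  using assms
proof (induction a arbitrary: p)
  case Nil
  then show ?case by (auto simp: petals_def intro: exI[of _ "[]"])
next
  case (Cons c a)
  let ?q = "take (2 * c) p" and ?r = "drop (2 * c) p"
  have p: "distinct (?q @ ?r)" "successively E (?q @ ?r)" "set (?q @ ?r) \<subseteq> V" "\<forall>v\<in>set (?q @ ?r). E u v"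
    using Cons.prems by (simp_all add: gpath_def)
  have s: "successively E ?q" "successively E ?r"
    using p(2) unfolding successively_append_iff by blast+
  have "\<exists>ps. petals E (V \<inter> set ?r) u a ps"
    using Cons.prems(3,4) p s by (intro Cons.IH) (auto simp: gpath_def dest: in_set_dropD)
  then obtain ps where ps: "petals E (V \<inter> set ?r) u a ps" by blast
  have ne: "?q \<noteq> []" using Cons.prems by auto
  have sub: "set ?q \<subseteq> set p" "set ?r \<subseteq> set p" by (simp_all add: set_take_subset set_drop_subset)
  have "petals E (V \<inter> set p) u (c # a) (?q # ps)"
  proof (rule petals_Cons)
    show "petals E (V \<inter> set p - set ?q) u a ps"
      using p(1) sub by (intro petals_mono[OF ps]) (auto simp del: append_take_drop_id)
    show "length ?q = 2 * c" using Cons.prems by simp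
    have "u \<notin> set p" using Cons.prems(2) irrefl by blast
    then show "set ?q \<subseteq> V \<inter> set p - {u}" using p(3) sub by auto
    show "E u (hd ?q)" "E u (last ?q)" using hd_in_set[OF ne] last_in_set[OF ne] p(4) unfolding set_append by blast+
  qed (use p s in auto)
  then show ?case by blast
qed

text \<open>Only the end points of a petal have to be neighbours of \<open>u\<close>, so the longest petal may have a
  vertex outside the neighbourhood of \<open>u\<close> in its interior.\<close>
lemma first_petal:
  assumes "gpath E V p" "2 * (b + sum_list a) \<le> length p" "b \<ge> 1" "\<forall>c\<in>set a. 1 \<le> c"
    and "u \<notin> set p" "E u (p ! 0)" "E u (p ! (2 * b - 1))" "\<forall>v\<in>set (drop (2 * b) p). E u v"
  shows "\<exists>ps. petals E V u (b # a) ps"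
proof -
  let ?q = "take (2 * b) p" and ?r = "drop (2 * b) p"
  have p: "distinct (?q @ ?r)" "successively E (?q @ ?r)" "set (?q @ ?r) \<subseteq> V"
    using assms by (simp_all add: gpath_def)
  have s: "successively E ?q" "successively E ?r"
    using p(2) unfolding successively_append_iff by blast+
  have "\<exists>ps. petals E (V \<inter> set ?r) u a ps"
    using assms p s by (intro path_petals) (auto simp: gpath_def dest: in_set_dropD)
  then obtain ps where ps: "petals E (V \<inter> set ?r) u a ps" by blast
  have l: "length ?q = 2 * b" using assms by simp
  have ne: "?q \<noteq> []" using l assms(3) by force
  have "petals E V u (b # a) (?q # ps)"
  proof (rule petals_Cons)
    show "petals E (V - set ?q) u a ps"
      using p(1) by (intro petals_mono[OF ps]) (auto simp del: append_take_drop_id)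
    show "set ?q \<subseteq> V - {u}" using p(3) assms(5) by (auto simp del: append_take_drop_id dest: in_set_takeD)
    show "E u (hd ?q)" using ne assms(3,6) by (simp add: hd_conv_nth)
    show "E u (last ?q)" using ne l assms(3,7) by (simp add: last_conv_nth)
  qed (use p s l in auto)
  then show ?thesis by blast
qed

text \<open>The exceptional vertex \<open>z\<close> is harmful only as an end point of the first
  petal, at position \<open>0\<close> or \<open>2 * b - 1\<close>. The path has a vertex to spare,
  so the window can then be shifted by one: \<open>z\<close> drops out or moves into the
  interior.\<close>

lemma path_avoiding_near_petals:
  assumes "gpath E V p" "2 * (b + sum_list a) < length p" "b \<ge> 2" "\<forall>c\<in>set a. 1 \<le> c"
    and "u \<notin> set p" "\<forall>v\<in>set p. v \<noteq> z \<longrightarrow> E u v" "z \<notin> set (drop (2 * b) p)"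
  shows "\<exists>ps. petals E V u (b # a) ps"
proof -
  have d: "\<forall>v\<in>set (drop (2 * b) p). E u v"
    using assms(6,7) by (metis in_set_dropD)
  have nz: "E u (p ! i)" if "i \<le> 2 * b" "p ! i \<noteq> z" for i
    using assms(2,6) that by auto
  have inj: "i = j" if "i \<le> 2 * b" "j \<le> 2 * b" "p ! i = z" "p ! j = z" for i j
  proof -
    have "i < length p" "j < length p" using that assms(2) by auto
    then show ?thesis using that(3,4) assms(1) nth_eq_iff_index_eq[of p i j] by (simp add: gpath_def)
  qed
  show ?thesis
  proof (cases "p ! 0 = z \<or> p ! (2 * b - 1) = z")
    case False
    then have "E u (p ! 0)" "E u (p ! (2 * b - 1))" using nz by simp_all
    then show ?thesis using assms d by (intro first_petal[of V p]) auto
  next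
    case True
    then have "\<exists>k \<in> {0, 2 * b - 1}. p ! k = z" by simp
    then obtain k where "k \<in> {0, 2 * b - 1}" and kz: "p ! k = z" by blast
    \<comment> \<open>\<open>k \<noteq> 1\<close> is where \<open>b \<ge> 2\<close> enters: a petal
      with only two vertices has no interior.\<close>
    then have k: "k \<le> 2 * b" "p ! k = z" "k \<noteq> 1" "k \<noteq> 2 * b" using assms(3) by auto
    have "p ! 1 \<noteq> z" using inj[OF k(1) _ k(2), of 1] k(3) assms(3) by linarith
    moreover have "p ! (2 * b) \<noteq> z" using inj[OF k(1) _ k(2), of "2 * b"] k(4) by linarith
    ultimately have e: "E u (tl p ! 0)" "E u (tl p ! (2 * b - 1))"
      using nz[of 1] nz[of "2 * b"] assms(2,3) by (simp_all add: nth_tl)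
    obtain x q where p: "p = x # q" using assms(2) by (cases p) auto
    have "gpath E V (tl p)"
      using assms(1) unfolding gpath_def p by (auto simp: successively_Cons)
    then show ?thesis
    proof (rule first_petal)
      have "set (drop (2 * b) (tl p)) \<subseteq> set (drop (2 * b) p)"
        using set_drop_subset_set_drop[of "2 * b" "Suc (2 * b)" p] by (simp add: drop_Suc)
      then show "\<forall>v\<in>set (drop (2 * b) (tl p)). E u v" using d by blast
      show "u \<notin> set (tl p)" using assms(5) p by simp
    qed (use assms e in auto)
  qed
qed

text \<open>If \<open>z\<close> lies beyond the first \<open>2 * b\<close> vertices, a shorter petal
  is cut off the front, which is free of \<open>z\<close> because \<open>c \<le> b\<close>. This is
  repeated until \<open>z\<close> is close enough to the front for the previous lemma, or until only
  the long petal is left and the front itself provides it.\<close>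

lemma path_minus_petals:
  assumes "gpath E V p" "2 * (b + sum_list a) < length p" "b \<ge> 2" "\<forall>c\<in>set a. 1 \<le> c \<and> c \<le> b"
    and "u \<notin> set p" "\<forall>v\<in>set p. v \<noteq> z \<longrightarrow> E u v"
  shows "\<exists>ps. petals E V u (b # a) ps"
  using assms
proof (induction a arbitrary: V p)
  case Nil
  show ?case
  proof (cases "z \<in> set (drop (2 * b) p)")
    case True
    let ?q = "take (2 * b) p"
    have s: "distinct (?q @ drop (2 * b) p)" "successively E (?q @ drop (2 * b) p)"
      using Nil.prems by (simp_all add: gpath_def)
    then have "successively E ?q" "z \<notin> set ?q"
      using True unfolding successively_append_iff by (auto simp del: append_take_drop_id)
    then have "gpath E V ?q" "u \<notin> set ?q" "\<forall>v\<in>set ?q. E u v"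
      using Nil.prems unfolding gpath_def by (auto dest: in_set_takeD)
    moreover from this(3) have "E u (?q ! 0)" "E u (?q ! (2 * b - 1))"
      using Nil.prems(2,3) by (auto simp del: nth_take)
    ultimately show ?thesis using Nil.prems(2,3) by (intro first_petal[of V ?q]) auto
  qed (use Nil.prems path_avoiding_near_petals in blast)
next
  case (Cons c a)
  note prems = Cons.prems
  show ?case
  proof (cases "z \<in> set (drop (2 * b) p)")
    case False
    then show ?thesis using path_avoiding_near_petals[OF prems(1-3) _ prems(5,6)] prems(4) by blast
  next
    case True
    let ?q = "take (2 * c) p" and ?r = "drop (2 * c) p"
    have c: "c \<le> b" "1 \<le> c" using prems(4) by auto
    have p: "distinct (?q @ ?r)" "successively E (?q @ ?r)" "set (?q @ ?r) \<subseteq> V"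
      using prems by (simp_all add: gpath_def)
    have s: "successively E ?q" "successively E ?r"
      using p(2) unfolding successively_append_iff by blast+
    have "z \<in> set ?r" using True c set_drop_subset_set_drop[of "2 * c" "2 * b" p] by auto
    then have zq: "z \<notin> set ?q" using p(1) by (auto simp del: append_take_drop_id)
    have "\<exists>ps. petals E (V \<inter> set ?r) u (b # a) ps"
      using prems p s by (intro Cons.IH[of "V \<inter> set ?r" ?r]) (auto simp: gpath_def dest: in_set_dropD)
    then obtain ps where ps: "petals E (V \<inter> set ?r) u (b # a) ps" by blast
    have ne: "?q \<noteq> []" using prems c by auto
    have Eq: "\<forall>v\<in>set ?q. E u v" using prems(6) zq by (metis in_set_takeD)
    have "petals E V u (c # b # a) (?q # ps)"
    proof (rule petals_Cons)
      show "petals E (V - set ?q) u (b # a) ps"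
        using p(1) by (intro petals_mono[OF ps]) (auto simp del: append_take_drop_id)
      show "set ?q \<subseteq> V - {u}" using p(3) prems(5) by (auto simp del: append_take_drop_id dest: in_set_takeD)
      show "E u (hd ?q)" "E u (last ?q)" using hd_in_set[OF ne] last_in_set[OF ne] Eq by blast+
    qed (use p s prems in auto)
    then have "petals E V u (b # c # a) (?q # ps)" by (simp add: petals_def add_mset_commute)
    then show ?thesis by blast
  qed
qed

end

section \<open>Eigenvalues of the signless Laplacian\<close>

context
  fixes V :: "'a set" and E :: "'a \<Rightarrow> 'a \<Rightarrow> bool" and h :: "nat \<Rightarrow> 'a" and n :: nat
  assumes h: "bij_betw h {..<n} V"
begin

text \<open>Numbering the vertices by \<open>h\<close> turns the operator into a matrix; over the
  complex numbers its characteristic polynomial is certain to have a root.\<close>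

definition Q_mat :: "complex mat" where
  "Q_mat = mat n n (\<lambda>(i, j). (if i = j then of_nat (Defs.degree V E (h i)) else 0) +
     (if E (h i) (h j) then 1 else 0))"

lemma Q_mat_mult:
  assumes "i < n" "v \<in> carrier_vec n"
  shows "(Q_mat *\<^sub>v v) $ i =
    of_nat (Defs.degree V E (h i)) * v $ i + (\<Sum>j<n. if E (h i) (h j) then v $ j else 0)"
proof -
  have "(Q_mat *\<^sub>v v) $ i = (\<Sum>j<n. ((if i = j then of_nat (Defs.degree V E (h i)) else 0) +
     (if E (h i) (h j) then 1 else 0)) * v $ j)"
    using assms by (simp add: Q_mat_def scalar_prod_def lessThan_atLeast0)
  also have "\<dots> = (\<Sum>j<n. (if i = j then of_nat (Defs.degree V E (h i)) * v $ j else 0) +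
     (if E (h i) (h j) then v $ j else 0))"
    by (intro sum.cong refl) (auto simp: algebra_simps)
  finally show ?thesis using assms by (simp add: sum.distrib)
qed

lemma Q_apply_reindex:
  "signless_lap_apply V E x (h i) =
    real (Defs.degree V E (h i)) * x (h i) + (\<Sum>j<n. if E (h i) (h j) then x (h j) else 0)"
  unfolding signless_lap_apply_def by (subst sum.reindex_bij_betw[OF h, symmetric]) simp

lemma eigenvalue_Q_mat:
  assumes "Q_eigenvalue V E mu"
  shows "eigenvalue Q_mat (complex_of_real mu)"
proof -
  obtain x where x: "\<exists>v\<in>V. x v \<noteq> 0" "\<And>v. v \<in> V \<Longrightarrow> signless_lap_apply V E x v = mu * x v"
    using assms unfolding Q_eigenvalue_def by blast
  define w where "w = vec n (\<lambda>i. complex_of_real (x (h i)))"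
  have dim: "dim_row Q_mat = n" by (simp add: Q_mat_def)
  have wc: "w \<in> carrier_vec n" by (simp add: w_def)
  obtain i where i: "i < n" "x (h i) \<noteq> 0" using x(1) bij_betw_imp_surj_on[OF h] by blast
  have "w \<noteq> 0\<^sub>v n"
  proof
    assume "w = 0\<^sub>v n"
    then have "w $ i = 0" using i(1) by simp
    then show False using i by (simp add: w_def)
  qed
  moreover have "Q_mat *\<^sub>v w = complex_of_real mu \<cdot>\<^sub>v w"
  proof (rule eq_vecI)
    fix i assume "i < dim_vec (complex_of_real mu \<cdot>\<^sub>v w)"
    then have i: "i < n" by (simp add: w_def)
    have "h i \<in> V" using i bij_betw_apply[OF h] by simp
    have "(Q_mat *\<^sub>v w) $ i = of_nat (Defs.degree V E (h i)) * w $ i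
        + (\<Sum>j<n. if E (h i) (h j) then w $ j else 0)"
      by (rule Q_mat_mult[OF i wc])
    also have "\<dots> = complex_of_real (signless_lap_apply V E x (h i))"
      unfolding Q_apply_reindex using i
      by (simp add: w_def if_distrib[of complex_of_real] cong: if_cong)
    also have "\<dots> = (complex_of_real mu \<cdot>\<^sub>v w) $ i" using x(2)[OF \<open>h i \<in> V\<close>] i by (simp add: w_def)
    finally show "(Q_mat *\<^sub>v w) $ i = (complex_of_real mu \<cdot>\<^sub>v w) $ i" .
  qed (simp add: dim w_def)
  ultimately show ?thesis using wc unfolding eigenvalue_def eigenvector_def dim by blast
qed

text \<open>\<open>q_index\<close> is a \<open>Max\<close>, which is meaningful only for a finite
  non-empty set. Finiteness holds because eigenvalues are roots of the characteristic
  polynomial.\<close>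

lemma finite_Q_eigenvalues: "finite {mu. Q_eigenvalue V E mu}"
proof -
  have c: "Q_mat \<in> carrier_mat n n" by (simp add: Q_mat_def)
  have "char_poly Q_mat \<noteq> 0" using degree_monic_char_poly[OF c] by auto
  then have "finite {k. poly (char_poly Q_mat) k = 0}" by (rule poly_roots_finite)
  moreover have "complex_of_real ` {mu. Q_eigenvalue V E mu} \<subseteq> {k. poly (char_poly Q_mat) k = 0}"
    using eigenvalue_Q_mat eigenvalue_root_char_poly[OF c] by auto
  ultimately show ?thesis
    by (meson finite_imageD finite_subset inj_of_real inj_on_subset subset_UNIV)
qed

text \<open>The eigenvalue of the complex matrix is real because \<open>Q\<close> is symmetric, and the real or the
  imaginary part of the eigenvector is a real eigenvector.\<close>
lemma Q_eigenvalue_exists_indexed: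
  assumes sym: "\<And>u v. E u v \<Longrightarrow> E v u" and n: "n > 0"
  shows "\<exists>mu. Q_eigenvalue V E mu"
proof -
  have c: "Q_mat \<in> carrier_mat n n" and dim: "dim_row Q_mat = n" by (simp_all add: Q_mat_def)
  have "Polynomial.degree (char_poly Q_mat) > 0" using degree_monic_char_poly[OF c] n by simp
  then have "\<not> constant (poly (char_poly Q_mat))" by (simp add: constant_degree)
  from fundamental_theorem_of_algebra[OF this] obtain k where "eigenvalue Q_mat k"
    using eigenvalue_root_char_poly[OF c] by blast
  then obtain w where wc: "w \<in> carrier_vec n" and w0: "w \<noteq> 0\<^sub>v n" and wk: "Q_mat *\<^sub>v w = k \<cdot>\<^sub>v w"
    unfolding eigenvalue_def eigenvector_def dim by blast
  let ?d = "\<lambda>i. complex_of_nat (Defs.degree V E (h i))"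
  have eq: "?d i * w $ i + (\<Sum>j<n. if E (h i) (h j) then w $ j else 0) = k * w $ i" if "i < n" for i
    using Q_mat_mult[OF that wc] wk that wc by simp
  obtain i0 where i0: "i0 < n" "w $ i0 \<noteq> 0" using w0 wc by (metis carrier_vecD eq_vecI index_zero_vec)
  \<comment> \<open>\<open>S\<close> is the Hermitian form of \<open>Q_mat\<close> at
    \<open>w\<close> and \<open>N\<close> the squared norm; \<open>S = k N\<close> with
    \<open>S\<close> real and \<open>N > 0\<close> makes \<open>k\<close> real.\<close>
  define S where "S = (\<Sum>i<n. cnj (w $ i) * (?d i * w $ i)) +
    (\<Sum>i<n. \<Sum>j<n. if E (h i) (h j) then cnj (w $ i) * w $ j else 0)"
  define N where "N = (\<Sum>i<n. (cmod (w $ i))\<^sup>2)"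
  have "S = (\<Sum>i<n. cnj (w $ i) * (?d i * w $ i + (\<Sum>j<n. if E (h i) (h j) then w $ j else 0)))"
    unfolding S_def by (simp add: sum.distrib distrib_left sum_distrib_left if_distrib cong: if_cong)
  also have "\<dots> = (\<Sum>i<n. k * (cnj (w $ i) * w $ i))"
    by (intro sum.cong refl) (simp add: eq)
  also have "\<dots> = k * complex_of_real N"
    unfolding N_def of_real_sum sum_distrib_left by (intro sum.cong refl) (metis complex_norm_square mult.commute)
  finally have SN: "S = k * complex_of_real N" .
  have "cnj S = (\<Sum>i<n. cnj (w $ i) * (?d i * w $ i)) +
    (\<Sum>i<n. \<Sum>j<n. if E (h i) (h j) then cnj (w $ j) * w $ i else 0)"
    unfolding S_def by (simp add: mult_ac if_distrib[of cnj] cong: if_cong)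
  also have "(\<Sum>i<n. \<Sum>j<n. if E (h i) (h j) then cnj (w $ j) * w $ i else 0) =
      (\<Sum>i<n. \<Sum>j<n. if E (h i) (h j) then cnj (w $ i) * w $ j else 0)"
    by (subst sum.swap) (intro sum.cong refl, use sym in metis)
  finally have "cnj S = S" unfolding S_def .
  moreover have "N > 0"
    unfolding N_def by (rule sum_pos2[of _ i0]) (use i0 in auto)
  ultimately have "cnj k = k" using SN by simp
  then have k: "k = complex_of_real (Re k)" by (metis Reals_cnj_iff of_real_Re)
  \<comment> \<open>\<open>p\<close> stands for the real and the imaginary part alike; as
    \<open>k\<close> is real, any real-linear map carries the eigenvector equation over.\<close>
  have part: "Q_eigenvalue V E (Re k)"
    if lin: "\<And>a b. p (a + b) = p a + p b" "\<And>r z. p (complex_of_real r * z) = r * p z"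
      and nz: "p (w $ i0) \<noteq> (0::real)" for p
  proof -
    define g where "g = inv_into {..<n} h"
    have gh: "g (h i) = i" if "i < n" for i
      using that bij_betw_imp_inj_on[OF h] by (simp add: g_def inv_into_f_f)
    have p0: "p 0 = 0" using lin(2)[of 0 0] by simp
    have psum: "p (sum f A) = (\<Sum>i\<in>A. p (f i))" if "finite A" for f :: "nat \<Rightarrow> complex" and A
      using that by (induction A rule: finite_induct) (simp_all add: lin p0)
    define x where "x = (\<lambda>v. p (w $ g v))"
    have "signless_lap_apply V E x v = Re k * x v" if "v \<in> V" for v
    proof -
      obtain i where i: "i < n" "v = h i" using \<open>v \<in> V\<close> bij_betw_imp_surj_on[OF h] by blast
      have "p (?d i * w $ i + (\<Sum>j<n. if E (h i) (h j) then w $ j else 0)) = p (k * w $ i)"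
        using eq[OF i(1)] by simp
      also have "p (k * w $ i) = Re k * p (w $ i)" by (subst k) (rule lin(2))
      also have "p (?d i * w $ i + (\<Sum>j<n. if E (h i) (h j) then w $ j else 0)) =
          real (Defs.degree V E (h i)) * p (w $ i) + (\<Sum>j<n. if E (h i) (h j) then p (w $ j) else 0)"
        unfolding lin(1) psum[OF finite_lessThan] using lin(2)[of "real (Defs.degree V E (h i))"]
        by (simp add: if_distrib[of p] p0 cong: if_cong)
      also have "\<dots> = signless_lap_apply V E x (h i)"
        unfolding Q_apply_reindex x_def gh[OF i(1)]
        by (intro arg_cong2[of _ _ _ _ plus] sum.cong refl) (simp add: gh)
      finally show ?thesis using i gh by (simp add: x_def)
    qed
    moreover have "\<exists>v\<in>V. x v \<noteq> 0"
      using nz i0(1) gh bij_betw_apply[OF h, of i0] by (intro bexI[of _ "h i0"]) (auto simp: x_def)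
    ultimately show ?thesis unfolding Q_eigenvalue_def by blast
  qed
  have "Re (w $ i0) \<noteq> 0 \<or> Im (w $ i0) \<noteq> 0" using i0(2) complex_eq_iff by auto
  then have "Q_eigenvalue V E (Re k)"
    using part[of Re] part[of Im] by auto
  then show ?thesis by blast
qed

end

section \<open>Comparison principles for the index\<close>

context sym_irrefl
begin

lemma Q_eigenvalues:
  assumes "finite V" "V \<noteq> {}"
  shows "finite {mu. Q_eigenvalue V E mu}" "{mu. Q_eigenvalue V E mu} \<noteq> {}"
proof -
  obtain h where "bij_betw h {0..<card V} V" using ex_bij_betw_nat_finite[OF assms(1)] by blast
  then have h: "bij_betw h {..<card V} V" by (simp add: lessThan_atLeast0)
  show "finite {mu. Q_eigenvalue V E mu}" by (rule finite_Q_eigenvalues[OF h])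
  have "card V > 0" using assms by (simp add: card_gt_0_iff)
  then show "{mu. Q_eigenvalue V E mu} \<noteq> {}" using Q_eigenvalue_exists_indexed[OF h] sym by blast
qed

lemma q_index_eigenvalue:
  assumes "finite V" "V \<noteq> {}"
  shows "Q_eigenvalue V E (q_index V E)"
  using Max_in[OF Q_eigenvalues[OF assms]] by (simp add: q_index_def)

lemma Q_symmetric:
  assumes "finite V"
  shows "(\<Sum>v\<in>V. x v * signless_lap_apply V E y v) = (\<Sum>v\<in>V. signless_lap_apply V E x v * y v)"
proof -
  have "(\<Sum>v\<in>V. \<Sum>u\<in>V. if E v u then x v * y u else 0) = (\<Sum>v\<in>V. \<Sum>u\<in>V. if E v u then x u * y v else 0)"
    by (subst sum.swap) (intro sum.cong refl, use sym in metis)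
  then show ?thesis
    unfolding signless_lap_apply_def
    by (simp add: sum.distrib distrib_left distrib_right sum_distrib_left sum_distrib_right if_distrib
        if_distribR mult_ac cong: if_cong)
qed

text \<open>Absolute values of an eigenvector and the triangle inequality. This takes the place of a
  nonnegative Perron eigenvector: later arguments start from the inequality alone.\<close>

lemma nonneg_subsolution:
  assumes "Q_eigenvalue V E mu"
  obtains z where "\<And>v. 0 \<le> z v" "\<exists>v\<in>V. 0 < z v" "\<And>v. v \<in> V \<Longrightarrow> mu * z v \<le> signless_lap_apply V E z v"
proof -
  obtain x where x: "\<exists>v\<in>V. x v \<noteq> 0" "\<And>v. v \<in> V \<Longrightarrow> signless_lap_apply V E x v = mu * x v"
    using assms unfolding Q_eigenvalue_def by blast
  have "mu * \<bar>x v\<bar> \<le> signless_lap_apply V E (\<lambda>v. \<bar>x v\<bar>) v" if "v \<in> V" for v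
  proof -
    have "mu * \<bar>x v\<bar> \<le> \<bar>signless_lap_apply V E x v\<bar>"
      unfolding x(2)[OF that] abs_mult by (intro mult_right_mono) auto
    also have "\<dots> \<le> real (Defs.degree V E v) * \<bar>x v\<bar> + (\<Sum>u\<in>V. \<bar>if E v u then x u else 0\<bar>)"
      unfolding signless_lap_apply_def
      by (rule order_trans[OF abs_triangle_ineq]) (intro add_mono sum_abs, simp add: abs_mult)
    also have "\<dots> = signless_lap_apply V E (\<lambda>v. \<bar>x v\<bar>) v"
      unfolding signless_lap_apply_def by (simp add: if_distrib cong: if_cong)
    finally show ?thesis .
  qed
  then show ?thesis using that[of "\<lambda>v. \<bar>x v\<bar>"] x(1) by fastforce
qed

text \<open>Pairing \<open>z\<close> with \<open>y\<close> and moving the symmetric operator across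
  gives \<open>mu <z, y> \<le> <Q z, y> = <z, Q y> \<le> lam <z, y>\<close>, where
  \<open><z, y> > 0\<close>. If \<open>mu = lam\<close>, equality holds term by term, and cancelling
  \<open>y v > 0\<close>, respectively \<open>z v > 0\<close>, yields the other two claims.\<close>

lemma collatz_bound:
  assumes V: "finite V" and z: "\<And>v. 0 \<le> z v" "\<exists>v\<in>V. 0 < z v"
    and zQ: "\<And>v. v \<in> V \<Longrightarrow> mu * z v \<le> signless_lap_apply V E z v"
    and y: "\<And>v. v \<in> V \<Longrightarrow> 0 < y v" and yQ: "\<And>v. v \<in> V \<Longrightarrow> signless_lap_apply V E y v \<le> lam * y v"
  shows "mu \<le> lam"
    and "mu = lam \<Longrightarrow> v \<in> V \<Longrightarrow> signless_lap_apply V E z v = lam * z v"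
    and "mu = lam \<Longrightarrow> v \<in> V \<Longrightarrow> 0 < z v \<Longrightarrow> signless_lap_apply V E y v = lam * y v"
proof -
  obtain v0 where v0: "v0 \<in> V" "0 < z v0" using z(2) by blast
  have pos: "0 < (\<Sum>v\<in>V. z v * y v)"
    by (rule sum_pos2[OF V v0(1)]) (use v0 y z(1) in \<open>auto intro: mult_nonneg_nonneg less_imp_le\<close>)
  have a: "mu * (z v * y v) \<le> signless_lap_apply V E z v * y v" if "v \<in> V" for v
    using mult_right_mono[OF zQ[OF that] less_imp_le[OF y[OF that]]] by (simp add: mult.assoc)
  have b: "z v * signless_lap_apply V E y v \<le> lam * (z v * y v)" if "v \<in> V" for v
    using mult_left_mono[OF yQ[OF that] z(1)[of v]] by (simp add: mult_ac)
  have "mu * (\<Sum>v\<in>V. z v * y v) \<le> (\<Sum>v\<in>V. signless_lap_apply V E z v * y v)"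
    unfolding sum_distrib_left by (rule sum_mono) (rule a)
  moreover have "(\<Sum>v\<in>V. signless_lap_apply V E z v * y v) \<le> lam * (\<Sum>v\<in>V. z v * y v)"
    unfolding Q_symmetric[OF V, symmetric] sum_distrib_left by (rule sum_mono) (rule b)
  ultimately show le: "mu \<le> lam" using pos by (meson mult_le_cancel_right_pos order_trans)
  assume eq: "mu = lam" and v: "v \<in> V"
  have e: "(\<Sum>v\<in>V. signless_lap_apply V E z v * y v) = lam * (\<Sum>v\<in>V. z v * y v)"
    using \<open>mu * _ \<le> _\<close> \<open>_ \<le> lam * _\<close> eq by simp
  have "(\<Sum>v\<in>V. signless_lap_apply V E z v * y v - lam * (z v * y v)) = 0"
    unfolding sum_subtractf e sum_distrib_left by simp
  then have "signless_lap_apply V E z v * y v - lam * (z v * y v) = 0"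
    using a eq v by (subst (asm) sum_nonneg_eq_0_iff[OF V]) auto
  then show "signless_lap_apply V E z v = lam * z v"
    using y[OF v] by (simp add: right_diff_distrib' left_diff_distrib' mult.assoc[symmetric])
  assume zv: "0 < z v"
  have "(\<Sum>v\<in>V. lam * (z v * y v) - z v * signless_lap_apply V E y v) = 0"
    unfolding sum_subtractf Q_symmetric[OF V] e sum_distrib_left by simp
  then have "lam * (z v * y v) - z v * signless_lap_apply V E y v = 0"
    using b v by (subst (asm) sum_nonneg_eq_0_iff[OF V]) auto
  then have "z v * signless_lap_apply V E y v = z v * (lam * y v)" by (simp only: right_minus_eq mult.left_commute)
  then show "signless_lap_apply V E y v = lam * y v" using zv by simp
qed

text \<open>Evaluates the candidate Perron vector, both on \<open>S_edge t\<close> and on a graph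
  compared with it.\<close>

lemma two_valued_apply:
  assumes V: "finite V" and L: "L \<subseteq> V" and v: "v \<in> V"
  shows "signless_lap_apply V E (\<lambda>w. if w \<in> L then 1 else b) v =
    (real (Defs.degree L E v) + real (Defs.degree (V - L) E v)) * (if v \<in> L then 1 else b)
    + real (Defs.degree L E v) + real (Defs.degree (V - L) E v) * b"
proof -
  have VL: "V = L \<union> (V - L)" using L by blast
  have f: "finite L" "finite (V - L)" using V L finite_subset by auto
  have "Defs.degree V E v = Defs.degree L E v + Defs.degree (V - L) E v"
    using degree_Un[OF f, of v] VL by simp
  moreover have "(\<Sum>u\<in>V. if E v u then if u \<in> L then 1 else b else 0) =
      (\<Sum>u\<in>L. if E v u then 1 else 0) + (\<Sum>u\<in>V - L. if E v u then b else 0)"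
  proof -
    have "(\<Sum>u\<in>L. if E v u then if u \<in> L then 1 else b else 0) = (\<Sum>u\<in>L. if E v u then 1 else 0)"
      "(\<Sum>u\<in>V - L. if E v u then if u \<in> L then 1 else b else 0) = (\<Sum>u\<in>V - L. if E v u then b else 0)"
      by (intro sum.cong refl; simp)+
    then show ?thesis unfolding sum.subset_diff[OF L V] by simp
  qed
  moreover have "(\<Sum>u\<in>L. if E v u then 1 else 0) = real (Defs.degree L E v)"
    unfolding Defs.degree_def using f by (simp add: sum.If_cases Int_def)
  moreover have "(\<Sum>u\<in>V - L. if E v u then b else 0) = real (Defs.degree (V - L) E v) * b"
    unfolding Defs.degree_def using f(2) by (simp add: sum.If_cases Int_def)
  ultimately show ?thesis unfolding signless_lap_apply_def by simp
qed

end

section \<open>Invariance of the index under isomorphism\<close>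

lemma graph_iso_sym:
  assumes "graph_iso V E V' E'"
  shows "graph_iso V' E' V E"
proof -
  obtain f where f: "bij_betw f V V'" "\<forall>x\<in>V. \<forall>y\<in>V. E x y \<longleftrightarrow> E' (f x) (f y)"
    using assms unfolding graph_iso_def by blast
  have "f (inv_into V f x) = x" "inv_into V f x \<in> V" if "x \<in> V'" for x
    using that f(1) by (auto simp: bij_betw_def f_inv_into_f inv_into_into)
  then have "\<forall>x\<in>V'. \<forall>y\<in>V'. E' x y \<longleftrightarrow> E (inv_into V f x) (inv_into V f y)"
    using f(2) by simp
  then show ?thesis using bij_betw_inv_into[OF f(1)] unfolding graph_iso_def by blast
qed

lemma graph_iso_Q_eigenvalue:
  assumes "graph_iso V E V' E'" "Q_eigenvalue V' E' mu"
  shows "Q_eigenvalue V E mu"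
proof -
  obtain f where f: "bij_betw f V V'" and iso: "\<And>x y. x \<in> V \<Longrightarrow> y \<in> V \<Longrightarrow> E x y \<longleftrightarrow> E' (f x) (f y)"
    using assms(1) unfolding graph_iso_def by blast
  obtain x where x: "\<exists>v\<in>V'. x v \<noteq> 0" "\<And>v. v \<in> V' \<Longrightarrow> signless_lap_apply V' E' x v = mu * x v"
    using assms(2) unfolding Q_eigenvalue_def by blast
  have "signless_lap_apply V E (x \<circ> f) v = mu * (x \<circ> f) v" if v: "v \<in> V" for v
  proof -
    have "bij_betw f {u \<in> V. E v u} {u \<in> V'. E' (f v) u}"
      using f v iso unfolding bij_betw_def inj_on_def by (auto simp: image_iff)
    then have "Defs.degree V E v = Defs.degree V' E' (f v)"
      unfolding Defs.degree_def by (rule bij_betw_same_card)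
    moreover have "(\<Sum>u\<in>V. if E v u then (x \<circ> f) u else 0) = (\<Sum>u\<in>V'. if E' (f v) u then x u else 0)"
      unfolding sum.reindex_bij_betw[OF f, symmetric] using iso v by (intro sum.cong) auto
    ultimately have "signless_lap_apply V E (x \<circ> f) v = signless_lap_apply V' E' x (f v)"
      unfolding signless_lap_apply_def by simp
    then show ?thesis using x(2) bij_betw_apply[OF f v] by simp
  qed
  moreover have "\<exists>v\<in>V. (x \<circ> f) v \<noteq> 0" using x(1) bij_betw_imp_surj_on[OF f] by auto
  ultimately show ?thesis unfolding Q_eigenvalue_def by blast
qed

lemma graph_iso_q_index:
  assumes "graph_iso V E V' E'"
  shows "q_index V E = q_index V' E'"
proof -
  have "{mu. Q_eigenvalue V E mu} = {mu. Q_eigenvalue V' E' mu}"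
    using graph_iso_Q_eigenvalue[OF assms] graph_iso_Q_eigenvalue[OF graph_iso_sym[OF assms]] by blast
  then show ?thesis by (simp add: q_index_def)
qed

section \<open>A dominating vertex and the hubs\<close>

text \<open>Row-sum bound for Q conjugated by the degree matrix, whose row sums are degree plus
  average neighbour degree. At a maximum \<open>u\<close> of \<open>f v = z v / d(v)\<close>, every
  neighbour satisfies \<open>z v \<le> f u * d(v)\<close>. The result is stated after multiplication
  by the degree of \<open>u\<close>.\<close>

lemma (in sym_irrefl) exists_large_row_sum:
  assumes V: "finite V" and z: "\<And>v. 0 \<le> z v" "\<exists>v\<in>V. 0 < z v"
    and zQ: "\<And>v. v \<in> V \<Longrightarrow> mu * z v \<le> signless_lap_apply V E z v" and mu: "0 < mu"
  obtains u where "u \<in> V" "0 < Defs.degree V E u"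
    "mu * real (Defs.degree V E u) \<le>
      (real (Defs.degree V E u))\<^sup>2 + (\<Sum>v\<in>{v \<in> V. E u v}. real (Defs.degree V E v))"
proof -
  let ?d = "\<lambda>v. real (Defs.degree V E v)"
  define f where "f = (\<lambda>v. z v / ?d v)"
  \<comment> \<open>At isolated vertices division by zero makes \<open>f\<close> vanish;
    \<open>z\<close> vanishes there too, since \<open>mu > 0\<close>.\<close>
  have zero: "z v = 0" if "v \<in> V" "?d v = 0" for v
  proof -
    have "{u \<in> V. E v u} = {}" using that(2) V by (simp add: Defs.degree_def)
    then have "(\<Sum>u\<in>V. if E v u then z u else 0) = 0" by (intro sum.neutral) auto
    then have "mu * z v \<le> 0" using zQ[OF that(1)] that(2) by (simp add: signless_lap_apply_def)
    then have "z v \<le> 0" using mu by (simp add: mult_le_0_iff)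
    then show ?thesis using z(1)[of v] by simp
  qed
  obtain v0 where v0: "v0 \<in> V" "0 < z v0" using z(2) by blast
  obtain u where u: "u \<in> V" and max: "\<And>v. v \<in> V \<Longrightarrow> f v \<le> f u"
  proof -
    have "Max (f ` V) \<in> f ` V" using V v0 by (intro Max_in) auto
    then obtain u where "u \<in> V" "f u = Max (f ` V)" by auto
    then show ?thesis using that V by simp
  qed
  have "?d v0 \<noteq> 0" using zero v0 by force
  then have "0 < f v0" using v0(2) by (simp add: f_def)
  then have fu: "0 < f u" using max[OF v0(1)] by simp
  then have du: "?d u \<noteq> 0" unfolding f_def by force
  have zu: "z u = f u * ?d u" using du by (simp add: f_def)
  have zv: "z v \<le> f u * ?d v" if "v \<in> V" for v
  proof (cases "?d v = 0")
    case False
    then show ?thesis using max[OF that] by (simp add: f_def pos_divide_le_eq)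
  qed (use zero that in simp)
  have "mu * z u \<le> ?d u * z u + (\<Sum>v\<in>{v \<in> V. E u v}. z v)"
    using zQ[OF u] V by (simp add: signless_lap_apply_def sum.If_cases Int_def)
  also have "(\<Sum>v\<in>{v \<in> V. E u v}. z v) \<le> (\<Sum>v\<in>{v \<in> V. E u v}. f u * ?d v)"
    by (rule sum_mono) (use zv in simp)
  finally have "f u * (mu * ?d u) \<le> f u * ((?d u)\<^sup>2 + (\<Sum>v\<in>{v \<in> V. E u v}. ?d v))"
    unfolding zu by (simp add: sum_distrib_left algebra_simps power2_eq_square)
  then have "mu * ?d u \<le> (?d u)\<^sup>2 + (\<Sum>v\<in>{v \<in> V. E u v}. ?d v)"
    using fu by (simp add: mult_le_cancel_left_pos)
  then show ?thesis using that u du by simp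
qed

text \<open>The longest cycle, of length \<open>2b + 1\<close>, is separated from the others; \<open>q\<close> will be the index
  of the extremal graph.\<close>
locale petal_free = sym_irrefl E for E :: "'a \<Rightarrow> 'a \<Rightarrow> bool" +
  fixes V :: "'a set" and b :: nat and a :: "nat list" and n t :: nat and q :: real
  assumes fin: "finite V" and edge_in: "E u v \<Longrightarrow> u \<in> V" and card_V: "card V = n"
    and b: "2 \<le> b" and a: "a \<noteq> []" "\<forall>c\<in>set a. 1 \<le> c \<and> c \<le> b" and t_def: "t = b + sum_list a"
    and free: "u \<in> V \<Longrightarrow> \<not> petals E V u (b # a) ps"
    and n: "8 * t^2 + 9 \<le> n + 12 * t"
    and q_root: "q * q = (real n + 2 * real t - 2) * q - 2 * real t * (real t - 1)"
    and q_gt: "real n + 2 * real t - 3 < q"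
begin

lemma t_ge: "3 \<le> t"
proof -
  obtain c a' where "a = c # a'" using a(1) by (cases a) auto
  then show ?thesis using a(2) b t_def by simp
qed

lemma n_ge: "8 * (real t)\<^sup>2 - 12 * real t + 9 \<le> real n"
proof -
  have "real (8 * t^2 + 9) \<le> real (n + 12 * t)" using n by (simp only: of_nat_le_iff)
  then show ?thesis by simp
qed

lemma t_sq: "3 * real t \<le> (real t)\<^sup>2"
  using t_ge by (simp add: power2_eq_square)

lemma q_big: "8 * (real t)\<^sup>2 - 10 * real t + 6 < q"
  using n_ge q_gt by linarith

text \<open>The quadratic says that \<open>n + 2t - 2 - q\<close> equals
  \<open>2t(t - 1) / q\<close>, and \<open>q > 8t^2 - 10t + 6\<close> exceeds
  \<open>7t(t - 1)\<close>. The deficit limits how far the estimates in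
  \<open>dominating_vertex\<close> can be from equality.\<close>

lemma q_deficit: "0 \<le> real n + 2 * real t - 2 - q" "real n + 2 * real t - 2 - q < 2 / 7"
proof -
  let ?D = "real n + 2 * real t - 2 - q"
  have D: "?D * q = 2 * real t * (real t - 1)" using q_root by (simp add: algebra_simps)
  have q0: "0 < q" using q_big t_sq t_ge by linarith
  have "0 \<le> 2 * real t * (real t - 1)" using t_ge by simp
  then show "0 \<le> ?D" using D q0 by (metis zero_le_mult_iff linorder_not_le order_less_le_trans)
  have "2 * real t * (real t - 1) = 2 * (real t)\<^sup>2 - 2 * real t"
    by (simp add: algebra_simps power2_eq_square)
  then have "7 * (?D * q) < 2 * q"
    unfolding D using q_big t_sq by linarith
  then have "(7 * ?D) * q < 2 * q" by (simp only: mult.assoc)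
  then show "?D < 2 / 7" using q0 by (simp only: mult_less_cancel_right_pos) simp
qed

lemma no_nbr_path:
  assumes "u \<in> V" "gpath E V p" "\<forall>v\<in>set p. E u v" shows "length p < 2 * t"
proof (rule ccontr)
  assume "\<not> length p < 2 * t"
  then have "\<exists>ps. petals E (V \<inter> set p) u (b # a) ps"
    using assms a b t_def by (intro path_petals) auto
  then show False using free[OF assms(1)] petals_mono by blast
qed

lemma nbr_degree_sum:
  assumes "u \<in> V"
  shows "(\<Sum>v\<in>{v \<in> V. E u v}. Defs.degree {v \<in> V. E u v} E v) \<le> (2 * t - 2) * card {v \<in> V. E u v}"
proof (rule erdos_gallai)
  show "\<nexists>p. gpath E {v \<in> V. E u v} p \<and> length p = 2 * t"
  proof
    assume "\<exists>p. gpath E {v \<in> V. E u v} p \<and> length p = 2 * t"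
    then obtain p where p: "gpath E {v \<in> V. E u v} p" "length p = 2 * t" by blast
    then have "length p < 2 * t"
      using assms by (intro no_nbr_path) (auto simp: gpath_def)
    then show False using p by simp
  qed
qed (use fin t_ge in auto)

text \<open>With a further neighbour \<open>x\<close> of \<open>u\<close>, the list
  \<open>x # z # p\<close> is a path on \<open>2 * t\<close> vertices. Its only vertex not adjacent
  to \<open>u\<close> is \<open>z\<close> in second place, interior to the first petal because
  \<open>b \<ge> 2\<close>.\<close>

lemma outside_not_joined:
  assumes u: "u \<in> V" and z: "z \<in> V" "z \<noteq> u" "\<not> E u z"
    and all: "\<forall>v\<in>V. E u v \<longrightarrow> E z v" and card: "2 * t - 2 < card {v \<in> V. E u v}"
    and p: "gpath E {v \<in> V. E u v} p" "length p = 2 * t - 2"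
  shows False
proof -
  have "card (set p) < card {v \<in> V. E u v}" using card p by (simp add: gpath_def distinct_card)
  then have "\<not> {v \<in> V. E u v} \<subseteq> set p" by (meson List.finite_set card_mono linorder_not_le)
  then obtain x where x: "x \<in> V" "E u x" "x \<notin> set p" by blast
  have pN: "\<forall>v\<in>set p. v \<in> V \<and> E u v" using p(1) by (auto simp: gpath_def)
  have ne: "p \<noteq> []" using p(2) t_ge by force
  define r where "r = x # z # p"
  have "x \<noteq> z" "z \<notin> set p" using x z pN by auto
  moreover have "E x z" using all x sym by blast
  moreover have "E z (hd p)" using all pN ne by (meson hd_in_set)
  ultimately have r: "gpath E V r"
    using p(1) x z ne unfolding r_def gpath_def by (auto simp: successively_Cons)
  have rl: "length r = 2 * (b + sum_list a)" using p(2) t_ge t_def by (simp add: r_def)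
  have in_p: "r ! (2 * b - 1) \<in> set p"
  proof -
    have "2 * b - 1 = Suc (Suc (2 * b - 3))" using b by linarith
    then show ?thesis using rl b by (simp add: r_def)
  qed
  have dr: "set (drop (2 * b) r) \<subseteq> set p"
  proof -
    have "2 * b = Suc (Suc (2 * b - 2))" using b by linarith
    then have "drop (2 * b) r = drop (2 * b - 2) p" unfolding r_def by (metis drop_Suc_Cons)
    then show ?thesis by (simp add: set_drop_subset)
  qed
  have "\<exists>ps. petals E V u (b # a) ps"
  proof (rule first_petal[OF r])
    show "u \<notin> set r" using x z pN irrefl unfolding r_def by auto
    show "E u (r ! 0)" using x by (simp add: r_def)
    show "E u (r ! (2 * b - 1))" using in_p pN by blast
    show "\<forall>v\<in>set (drop (2 * b) r). E u v" using dr pN by blast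
  qed (use rl a b in auto)
  then show False using free[OF u] by blast
qed

lemma dominating_vertex:
  assumes z: "\<And>v. 0 \<le> z v" "\<exists>v\<in>V. 0 < z v"
    and zQ: "\<And>v. v \<in> V \<Longrightarrow> mu * z v \<le> signless_lap_apply V E z v" and mu: "q \<le> mu"
  obtains u where "u \<in> V" "\<forall>v\<in>V - {u}. E u v" "mu \<le> real n + 2 * real t - 2"
proof -
  have "0 < mu" using mu q_big t_sq t_ge by linarith
  then obtain u where u: "u \<in> V" "0 < Defs.degree V E u" and row: "mu * real (Defs.degree V E u) \<le>
      (real (Defs.degree V E u))\<^sup>2 + (\<Sum>v\<in>{v \<in> V. E u v}. real (Defs.degree V E v))"
    using exists_large_row_sum[OF fin z zQ] by blast
  define N where "N = {v \<in> V. E u v}"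
  define W where "W = V - insert u N"
  define d where "d = card N"
  define w where "w = card W"
  define g where "g = (\<Sum>v\<in>N. Defs.degree N E v)"
  define e where "e = (\<Sum>v\<in>W. Defs.degree N E v)"
  have finN: "finite N" "finite W" using fin by (simp_all add: N_def W_def)
  have uN: "u \<notin> N" using irrefl by (simp add: N_def)
  have d: "Defs.degree V E u = d" by (simp add: Defs.degree_def d_def N_def)
  have d0: "0 < d" using u(2) d by simp
  have VNW: "V = ({u} \<union> N) \<union> W" using u(1) by (auto simp: N_def W_def)
  have disj: "{u} \<inter> N = {}" "({u} \<union> N) \<inter> W = {}" using uN by (auto simp: W_def)
  have "card V = card ({u} \<union> N) + card W"
    using VNW disj(2) finN by (metis card_Un_disjoint finite_Un finite.emptyI finite_insert)
  also have "card ({u} \<union> N) = 1 + card N" using uN finN by simp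
  finally have nd: "n = 1 + d + w" by (simp add: card_V d_def w_def)
  have deg: "Defs.degree V E v = 1 + Defs.degree N E v + Defs.degree W E v" if "v \<in> N" for v
  proof -
    have "{x \<in> {u}. E v x} = {u}" using that sym by (auto simp: N_def)
    then have "Defs.degree {u} E v = 1" by (simp add: Defs.degree_def)
    then show ?thesis
      using degree_Un[of "{u} \<union> N" W v] degree_Un[of "{u}" N v] finN disj VNW by simp
  qed
  have "(\<Sum>v\<in>N. Defs.degree V E v) = (\<Sum>v\<in>N. 1 + Defs.degree N E v + Defs.degree W E v)"
    by (intro sum.cong refl deg)
  also have "\<dots> = d + g + e"
    unfolding sum.distrib edge_count_swap[OF finN] by (simp add: d_def g_def e_def)
  finally have sumN: "(\<Sum>v\<in>N. real (Defs.degree V E v)) = real d + real g + real e"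
    by (metis of_nat_add of_nat_sum)
  have row': "mu * real d \<le> real d * real d + real d + real g + real e"
    using row sumN by (simp add: d N_def power2_eq_square)
  have g_le: "g \<le> (2 * t - 2) * d" using nbr_degree_sum[OF u(1)] by (simp add: N_def g_def d_def)
  then have "real g \<le> real ((2 * t - 2) * d)" by (simp only: of_nat_le_iff)
  then have g_le': "real g \<le> (2 * real t - 2) * real d" using t_ge by (simp add: of_nat_diff)
  have nr: "real n = 1 + real d + real w" by (simp add: nd)
  show ?thesis
  proof (cases "W = {}")
    case True
    then have e0: "e = 0" "w = 0" by (simp_all add: e_def w_def)
    have "mu * real d \<le> (real d + 1 + (2 * real t - 2)) * real d"
      using row' g_le' e0 by (simp add: algebra_simps)
    then have "mu \<le> real d + 1 + (2 * real t - 2)"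
      using d0 by (subst (asm) mult_le_cancel_right_pos) simp_all
    then have "mu \<le> real n + 2 * real t - 2" using nr e0 by simp
    moreover have "\<forall>v\<in>V - {u}. E u v" using True by (auto simp: W_def N_def)
    ultimately show ?thesis using that u(1) by blast
  next
    case False
    define D where "D = real n + 2 * real t - 2 - q"
    have D: "0 \<le> D" "D < 2 / 7" using q_deficit by (simp_all add: D_def)
    have w0: "1 \<le> w" using False finN by (simp add: w_def Suc_le_eq card_gt_0_iff)
    have "q * real d \<le> mu * real d" using mu by (simp add: mult_right_mono)
    then have ge: "real d * (real w + 2 * real t - 2 - D) \<le> real g + real e"
      using row' nr by (simp add: D_def algebra_simps)
    define c where "c = Max (Defs.degree N E ` W)"
    have "c \<in> Defs.degree N E ` W" unfolding c_def using finN False by (intro Max_in) auto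
    then obtain x where x: "x \<in> W" "Defs.degree N E x = c" by auto
    have "Defs.degree N E v \<le> c" if "v \<in> W" for v unfolding c_def using finN that by simp
    then have "e \<le> w * c" unfolding e_def w_def using sum_bounded_above[of W "Defs.degree N E" c] by simp
    then have "real e \<le> real (w * c)" by (simp only: of_nat_le_iff)
    then have e_le: "real e \<le> real w * real c" by simp
    have cd: "c \<le> d" using degree_le_card[OF finN(1), of x] x by (simp add: d_def)
    have e_le': "real e \<le> real w * real d" using e_le cd by (meson mult_left_mono of_nat_0_le_iff of_nat_le_iff order_trans)
    have xV: "x \<in> V" "x \<noteq> u" "\<not> E u x" "x \<notin> N" using x(1) by (auto simp: W_def N_def)
    have False
    proof (cases "c = d")
      \<comment> \<open>\<open>x\<close> is joined to all of \<open>N\<close>. Since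
        \<open>D < 1\<close>, the count gives \<open>d > 2t - 2\<close>, hence a neighbour to spare,
        and \<open>g > (2t - 4) d\<close>, hence a path on \<open>2t - 2\<close> vertices.\<close>
      case True
      have "{v \<in> N. E x v} = N"
        using True x(2) finN by (intro card_subset_eq) (auto simp: Defs.degree_def d_def)
      then have all: "\<forall>v\<in>V. E u v \<longrightarrow> E x v" by (auto simp: N_def)
      have g_ge: "real d * (2 * real t - 2 - D) \<le> real g" using ge e_le' by (simp add: algebra_simps)
      have "g \<le> (\<Sum>v\<in>N. d - 1)"
        unfolding g_def by (rule sum_mono) (use degree_less_card[OF finN(1)] in \<open>simp add: d_def\<close>)
      then have "g \<le> d * (d - 1)" by (simp add: d_def)
      then have "real g \<le> real (d * (d - 1))" by (simp only: of_nat_le_iff)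
      then have "real g \<le> real d * (real d - 1)" using d0 by (simp add: of_nat_diff)
      then have "real d * (2 * real t - 2 - D) \<le> real d * (real d - 1)" using g_ge by linarith
      then have "2 * real t - 2 - D \<le> real d - 1" using d0 by (subst (asm) mult_le_cancel_left_pos) simp_all
      then have "2 * real t - 2 < real d" using D by linarith
      then have "real (2 * t) < real (d + 2)" by simp
      then have "2 * t < d + 2" by (simp only: of_nat_less_iff)
      then have dt: "2 * t - 2 < d" using t_ge by linarith
      obtain p where p: "gpath E N p" "length p = 2 * t - 2"
      proof (rule ccontr)
        assume "\<not> thesis"
        then have "\<nexists>p. gpath E N p \<and> length p = 2 * t - 2" using that by blast
        then have "g \<le> (2 * t - 2 - 2) * d" 
          unfolding g_def d_def using finN(1) t_ge by (intro erdos_gallai) auto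
        then have "real g \<le> real ((2 * t - 2 - 2) * d)" by (simp only: of_nat_le_iff)
        then have "real g \<le> real d * (2 * real t - 4)" using t_ge by (simp add: of_nat_diff mult.commute)
        then have "real d * (2 * real t - 2 - D) \<le> real d * (2 * real t - 4)" using g_ge by linarith
        then have "2 * real t - 2 - D \<le> 2 * real t - 4" using d0 by (subst (asm) mult_le_cancel_left_pos) simp_all
        then show False using D by linarith
      qed
      show False
        using outside_not_joined[OF u(1) xV(1-3) all _ _ p(2)] dt p(1) by (simp add: N_def d_def)
    next
      case False
      then have "real c + 1 \<le> real d" using cd by linarith
      \<comment> \<open>Each vertex of \<open>W\<close> now misses some vertex of \<open>N\<close>,
        which costs at least \<open>w\<close> edges. So \<open>w \<le> D d\<close>, and
        \<open>N\<close> contains at least 7/9 of the vertices other than \<open>u\<close>.\<close>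
      have wc: "real w * (real d - real c) \<le> D * real d"
        using ge g_le' e_le by (simp add: algebra_simps)
      have "real w * 1 \<le> real w * (real d - real c)"
        using \<open>real c + 1 \<le> real d\<close> by (intro mult_left_mono) simp_all
      also have "\<dots> \<le> D * real d" by (rule wc)
      also have "\<dots> \<le> 2 / 7 * real d" using D by (intro mult_right_mono) simp_all
      finally have "real n - 1 \<le> 9 / 7 * real d" using nr by simp
      then have "8 * (real t)\<^sup>2 - 12 * real t + 8 \<le> 9 / 7 * real d" using n_ge by linarith
      then have d5: "5 * real t \<le> real d" using t_sq t_ge by linarith
      \<comment> \<open>\<open>g + 2 * c\<close> is the degree sum of \<open>N\<close> together with
        \<open>x\<close>. If \<open>x\<close> is the only outside vertex, the deficit is paid twice;
        otherwise all but two of the \<open>w\<close> terms \<open>c\<close> are bounded by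
        \<open>d\<close>.\<close>
      have gc: "real d * (2 * real t - 2 * D) \<le> real g + 2 * real c"
      proof (cases "w = 1")
        case True
        then have "real d * (2 * real t - 1 - D) \<le> real g + real c" using ge e_le by (simp add: algebra_simps)
        moreover have "real d - D * real d \<le> real c" using wc True by simp
        ultimately show ?thesis by (simp add: algebra_simps)
      next
        case False
        then have w2: "0 \<le> real w - 2" using w0 by simp
        have "(real w - 2) * real c \<le> (real w - 2) * real d" using w2 cd by (intro mult_left_mono) simp_all
        moreover have "0 \<le> D * real d" using D by simp
        ultimately show ?thesis using ge e_le by (simp add: algebra_simps)
      qed
      \<comment> \<open>The left side is the Erdos-Gallai bound for paths on \<open>2t + 1\<close>
        vertices in \<open>N \<union> {x}\<close>, one more than \<open>2t\<close>, as
        \<open>path_minus_petals\<close> demands. Below, \<open>3 / 7\<close> is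
        \<open>1 - 2 * (2 / 7)\<close>.\<close>
      have "(2 * real t - 1) * (real d + 1) < real d * (2 * real t - 2 * D)"
      proof -
        have "3 / 7 * (5 * real t) \<le> 3 / 7 * real d" using d5 by simp
        also have "\<dots> \<le> (1 - 2 * D) * real d" using D by (intro mult_right_mono) simp_all
        finally have "2 * real t - 1 < (1 - 2 * D) * real d" by simp
        then show ?thesis by (simp add: algebra_simps)
      qed
      then have big: "(2 * real t - 1) * (real d + 1) < real g + 2 * real c" using gc by linarith
      have zx: "Defs.degree {x} E x = 0" using irrefl by (simp add: Defs.degree_def)
      have sumx: "(\<Sum>v\<in>N \<union> {x}. Defs.degree (N \<union> {x}) E v) = g + 2 * c"
        using degree_sum_Un[of N "{x}"] finN xV(4) zx x(2) by (simp add: g_def)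
      obtain p where p: "gpath E (N \<union> {x}) p" "length p = 2 * t + 1"
      proof (rule ccontr)
        assume "\<not> thesis"
        then have "\<nexists>p. gpath E (N \<union> {x}) p \<and> length p = 2 * t + 1" using that by blast
        then have "g + 2 * c \<le> (2 * t + 1 - 2) * card (N \<union> {x})" 
          unfolding sumx[symmetric] using finN(1) t_ge by (intro erdos_gallai) auto
        also have "card (N \<union> {x}) = d + 1" using finN xV(4) by (simp add: d_def)
        finally have "real (g + 2 * c) \<le> real ((2 * t + 1 - 2) * (d + 1))" by (simp only: of_nat_le_iff)
        then have "real g + 2 * real c \<le> (2 * real t - 1) * (real d + 1)"
          using t_ge by (simp add: of_nat_diff distrib_left)
        then show False using big by linarith
      qed
      have "N \<union> {x} \<subseteq> V" using xV by (auto simp: N_def)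
      then have "gpath E V p" using p(1) unfolding gpath_def by blast
      moreover have "u \<notin> set p" "\<forall>v\<in>set p. v \<noteq> x \<longrightarrow> E u v"
        using p(1) uN xV by (auto simp: gpath_def N_def)
      ultimately have "\<exists>ps. petals E V u (b # a) ps"
        using a(2) b p(2) t_def by (intro path_minus_petals[of V p b a u x]) auto
      then show False using free[OF u(1)] by blast
    qed
    then show ?thesis ..
  qed
qed

text \<open>The subsolution is scaled so that its sum over \<open>V - {u}\<close> is \<open>\<mu> - n + 1\<close>; then no value there
  exceeds 1.\<close>
lemma scaled_subsolution:
  assumes u: "u \<in> V" "\<forall>v\<in>V - {u}. E u v"
    and z: "\<And>v. 0 \<le> z v" "\<exists>v\<in>V. 0 < z v"
    and zQ: "\<And>v. v \<in> V \<Longrightarrow> mu * z v \<le> signless_lap_apply V E z v"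
    and mu: "real n \<le> mu"
  obtains y where "\<And>v. 0 \<le> y v"
    "\<And>v. v \<in> V - {u} \<Longrightarrow> (mu - real (Defs.degree (V - {u}) E v)) * y v \<le> mu - real n + 2"
    "mu * (mu - real n) \<le> 2 * (\<Sum>v\<in>V - {u}. real (Defs.degree (V - {u}) E v) * y v)"
proof -
  define M where "M = V - {u}"
  define d where "d = (\<lambda>v. real (Defs.degree M E v))"
  define T where "T = (\<Sum>v\<in>M. z v)"
  \<comment> \<open>The row of \<open>u\<close> gives \<open>s * z u \<le> T\<close>, so scaling the
    sum \<open>T\<close> to \<open>s\<close> makes the value at \<open>u\<close> at most 1.\<close>
  define s where "s = mu - real n + 1"
  have s0: "0 < s" using mu by (simp add: s_def)
  have VM: "V = M \<union> {u}" "u \<notin> M" and finM: "finite M" using u(1) fin by (auto simp: M_def)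
  have "card V = Suc (card M)" using VM finM by (metis card_insert_disjoint insert_is_Un sup_commute)
  then have cM: "real (card M) = real n - 1" by (simp add: card_V)
  have T0: "0 \<le> T" unfolding T_def using z(1) by (intro sum_nonneg)
  have Qu: "signless_lap_apply V E z u = (real n - 1) * z u + T"
  proof -
    have "{v \<in> V. E u v} = M" using u(2) irrefl by (auto simp: M_def)
    then have "Defs.degree V E u = card M" by (simp add: Defs.degree_def)
    moreover have "(\<Sum>w\<in>V. if E u w then z w else 0) = T"
      unfolding T_def using \<open>{v \<in> V. E u v} = M\<close> fin by (simp add: sum.If_cases Int_def)
    ultimately show ?thesis using cM by (simp add: signless_lap_apply_def)
  qed
  have Qv: "signless_lap_apply V E z v = (d v + 1) * z v + z u + (\<Sum>w\<in>M. if E v w then z w else 0)"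
    if "v \<in> M" for v
  proof -
    have "E v u" using that u(2) sym by (auto simp: M_def)
    then have "{w \<in> {u}. E v w} = {u}" by auto
    then have "Defs.degree V E v = Defs.degree M E v + 1"
      using degree_Un[of M "{u}" v] VM finM by (simp add: Defs.degree_def)
    moreover have "(\<Sum>w\<in>V. if E v w then z w else 0) = z u + (\<Sum>w\<in>M. if E v w then z w else 0)"
      unfolding VM(1) using VM(2) finM \<open>E v u\<close> by simp
    ultimately show ?thesis by (simp add: signless_lap_apply_def d_def)
  qed
  have su: "s * z u \<le> T" using zQ[OF u(1)] unfolding Qu s_def by (simp add: algebra_simps)
  have Tpos: "0 < T"
  proof (rule ccontr)
    assume "\<not> 0 < T"
    then have "T = 0" using T0 by simp
    then have "\<forall>v\<in>M. z v = 0" using finM z(1) by (simp add: T_def sum_nonneg_eq_0_iff)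
    moreover have "z u \<le> 0" using su s0 \<open>T = 0\<close> by (simp add: mult_le_0_iff)
    ultimately show False using z(2) VM by force
  qed
  \<comment> \<open>The neighbours of \<open>v\<close> in \<open>M\<close> are replaced by all other
    vertices of \<open>M\<close>, so that \<open>v\<close> enters only through its degree.\<close>
  have up: "(mu - d v) * z v \<le> z u + T" if v: "v \<in> M" for v
  proof -
    have "(\<Sum>w\<in>M. if E v w then z w else 0) = (\<Sum>w\<in>M - {v}. if E v w then z w else 0)"
      unfolding sum.remove[OF finM v] using irrefl by simp
    also have "\<dots> \<le> (\<Sum>w\<in>M - {v}. z w)" by (intro sum_mono) (simp add: z(1))
    also have "\<dots> = T - z v" unfolding T_def using sum.remove[OF finM v, of z] by simp
    finally show ?thesis using zQ[of v] v VM Qv[OF v] by (simp add: algebra_simps)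
  qed
  \<comment> \<open>The rows are summed over \<open>M\<close>. In the double sum each
    \<open>z w\<close> occurs once per neighbour of \<open>w\<close>, which doubles the
    degree-weighted sum.\<close>
  have low: "(mu - 1) * T - (real n - 1) * z u \<le> 2 * (\<Sum>v\<in>M. d v * z v)"
  proof -
    have "mu * T \<le> (\<Sum>v\<in>M. signless_lap_apply V E z v)"
      unfolding T_def sum_distrib_left by (rule sum_mono) (use zQ VM in auto)
    also have "\<dots> = (\<Sum>v\<in>M. d v * z v) + T + (real n - 1) * z u
        + (\<Sum>v\<in>M. \<Sum>w\<in>M. if E v w then z w else 0)"
      by (simp add: Qv sum.distrib distrib_right T_def cM cong: sum.cong)
    also have "(\<Sum>v\<in>M. \<Sum>w\<in>M. if E v w then z w else 0) = (\<Sum>w\<in>M. d w * z w)"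
    proof -
      have "(\<Sum>v\<in>M. if E v w then z w else 0) = d w * z w" for w
      proof -
        have "{v \<in> M. E v w} = {v \<in> M. E w v}" using sym by blast
        then show ?thesis using finM by (simp add: d_def Defs.degree_def sum.If_cases Int_def)
      qed
      then show ?thesis by (subst sum.swap) simp
    qed
    finally show ?thesis by (simp add: algebra_simps)
  qed
  define y where "y = (\<lambda>v. s * z v / T)"
  have y0: "0 \<le> y v" for v using z(1) s0 Tpos by (simp add: y_def)
  have y1: "(mu - d v) * y v \<le> mu - real n + 2" if "v \<in> M" for v
  proof -
    have "s * ((mu - d v) * z v) \<le> s * (z u + T)" using up[OF that] s0 by (intro mult_left_mono) simp_all
    also have "\<dots> \<le> T * (s + 1)" using su by (simp add: algebra_simps)
    finally have "(mu - d v) * (s * z v) \<le> (s + 1) * T" by (simp add: algebra_simps)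
    then have "(mu - d v) * y v \<le> s + 1" using Tpos by (simp add: y_def pos_divide_le_eq)
    then show ?thesis by (simp add: s_def)
  qed
  have "mu * (mu - real n) \<le> 2 * (\<Sum>v\<in>M. d v * y v)"
  proof -
    have n1: "0 \<le> real n - 1" using cM by (metis of_nat_0_le_iff)
    have "(real n - 1) * (s * z u) \<le> (real n - 1) * T" using su n1 by (rule mult_left_mono)
    then have "((mu - 1) * s - (real n - 1)) * T \<le> s * ((mu - 1) * T - (real n - 1) * z u)"
      by (simp add: algebra_simps)
    also have "\<dots> \<le> s * (2 * (\<Sum>v\<in>M. d v * z v))" using low s0 by (intro mult_left_mono) simp_all
    finally have "(mu - 1) * s - (real n - 1) \<le> s * (2 * (\<Sum>v\<in>M. d v * z v)) / T"
      using Tpos by (simp add: pos_le_divide_eq)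
    also have "\<dots> = 2 * (\<Sum>v\<in>M. d v * y v)"
      by (simp add: y_def sum_distrib_left sum_divide_distrib mult_ac)
    also have "(mu - 1) * s - (real n - 1) = mu * (mu - real n)" by (simp add: s_def algebra_simps)
    finally show ?thesis .
  qed
  then show ?thesis using that[of y] y0 y1 unfolding M_def d_def by blast
qed

text \<open>A vertex that misses more than \<open>2t(t - 1)\<close> vertices has scaled value at most \<open>1/t\<close>, which is
  too little to contribute to the weighted degree sum.\<close>
lemma many_hubs:
  assumes u: "u \<in> V" "\<forall>v\<in>V - {u}. E u v"
    and z: "\<And>v. 0 \<le> z v" "\<exists>v\<in>V. 0 < z v"
    and zQ: "\<And>v. v \<in> V \<Longrightarrow> mu * z v \<le> signless_lap_apply V E z v"
    and mu: "q \<le> mu" "mu \<le> real n + 2 * real t - 2"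
  shows "t - 1 \<le> card {v \<in> V - {u}. n + 2 * t \<le> Defs.degree (V - {u}) E v + 2 * t\<^sup>2 + 1}"
proof (rule ccontr)
  define M where "M = V - {u}"
  define d where "d = (\<lambda>v. real (Defs.degree M E v))"
  define H where "H = {v \<in> M. n + 2 * t \<le> Defs.degree M E v + 2 * t\<^sup>2 + 1}"
  assume "\<not> ?thesis"
  then have "card H + 2 \<le> t" by (simp add: H_def M_def)
  then have cH: "real (card H) \<le> real t - 2" by linarith
  have t3: "3 \<le> real t" using t_ge by simp
  have mun: "real n + 2 * real t - 3 < mu" using mu q_gt by linarith
  have "real n \<le> mu" using mun t3 by linarith
  from scaled_subsolution[OF u z zQ this] obtain y where y0: "\<And>v. 0 \<le> y v"
    and y1: "\<And>v. v \<in> M \<Longrightarrow> (mu - d v) * y v \<le> mu - real n + 2"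
    and y2: "mu * (mu - real n) \<le> 2 * (\<Sum>v\<in>M. d v * y v)"
    unfolding M_def d_def by blast
  have VM: "V = insert u M" "u \<notin> M" and finM: "finite M" using u(1) fin by (auto simp: M_def)
  then have cM: "card M = n - 1" "0 < n" using card_V by auto
  have dM: "d v \<le> real n - 2" if "v \<in> M" for v
  proof -
    have "0 < card M" using that finM card_gt_0_iff by blast
    then show ?thesis using degree_less_card[OF finM that] cM unfolding d_def by linarith
  qed
  have yle1: "y v \<le> 1" if v: "v \<in> M" for v
  proof -
    have "(mu - real n + 2) * y v \<le> (mu - d v) * y v"
      using dM[OF v] y0[of v] by (intro mult_right_mono) linarith+
    also have "\<dots> \<le> (mu - real n + 2) * 1" using y1[OF v] by simp
    finally show ?thesis using mun t3 by (subst (asm) mult_le_cancel_left_pos) linarith+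
  qed
  \<comment> \<open>Off \<open>H\<close>, \<open>mu - d v \<ge> s + 2t(t - 1)\<close>, which is at
    least \<open>t s\<close> because \<open>s \<le> 2t\<close>; comparison with
    \<open>(mu - d v) * y v \<le> s\<close> gives the bound.\<close>
  have ysmall: "real t * y v \<le> 1" if v: "v \<in> M - H" for v
  proof -
    define s where "s = mu - real n + 2"
    have s: "0 < s" "s \<le> 2 * real t" using mun mu t3 by (simp_all add: s_def)
    have "Defs.degree M E v + 2 * t\<^sup>2 + 1 < n + 2 * t" using v by (auto simp: H_def)
    then have "real (Defs.degree M E v + 2 * t\<^sup>2 + 2) \<le> real (n + 2 * t)" by (simp only: of_nat_le_iff)
    then have "d v + 2 * (real t)\<^sup>2 + 2 \<le> real n + 2 * real t" by (simp add: d_def)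
    moreover have "(real t - 1) * s \<le> (real t - 1) * (2 * real t)"
      using s t3 by (intro mult_left_mono) simp_all
    ultimately have "real t * s \<le> mu - d v" by (simp add: s_def algebra_simps power2_eq_square)
    then have "real t * s * y v \<le> (mu - d v) * y v" using y0 by (rule mult_right_mono)
    also have "\<dots> \<le> s" using y1 v by (simp add: s_def)
    finally have "s * (real t * y v) \<le> s * 1" by (simp add: mult_ac)
    then show ?thesis using s by (subst (asm) mult_le_cancel_left_pos) simp_all
  qed
  have d0: "0 \<le> d v" for v by (simp add: d_def)
  have HM: "H \<subseteq> M" by (auto simp: H_def)
  \<comment> \<open>After multiplication by \<open>t\<close>, a non-hub contributes at most
    \<open>d v\<close> and a hub at most \<open>t * d v\<close>, so hubs count \<open>t - 1\<close>
    extra times. Too few hubs keep the sum small.\<close>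
  have "real t * (\<Sum>v\<in>M. d v * y v) = (\<Sum>v\<in>M - H. d v * (real t * y v)) + real t * (\<Sum>v\<in>H. d v * y v)"
    unfolding sum.subset_diff[OF HM finM] by (simp add: distrib_left sum_distrib_left mult_ac)
  also have "(\<Sum>v\<in>M - H. d v * (real t * y v)) \<le> (\<Sum>v\<in>M - H. d v * 1)"
    by (intro sum_mono mult_left_mono ysmall d0)
  also have "(\<Sum>v\<in>M - H. d v * 1) = (\<Sum>v\<in>M. d v) - (\<Sum>v\<in>H. d v)"
    unfolding sum.subset_diff[OF HM finM, of d] by simp
  also have "(\<Sum>v\<in>H. d v * y v) \<le> (\<Sum>v\<in>H. d v * 1)"
    using HM yle1 by (intro sum_mono mult_left_mono d0) auto
  finally have A: "real t * (\<Sum>v\<in>M. d v * y v) \<le> (\<Sum>v\<in>M. d v) + (real t - 1) * (\<Sum>v\<in>H. d v)"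
    using t3 by (simp add: algebra_simps)
  have "(\<Sum>v\<in>H. d v) \<le> real (card H) * (real n - 2)"
    using HM dM by (intro sum_bounded_above) auto
  also have "\<dots> \<le> (real t - 2) * (real n - 2)"
    using cH n_ge t_sq t3 by (intro mult_right_mono) linarith+
  finally have "(real t - 1) * (\<Sum>v\<in>H. d v) \<le> (real t - 1) * ((real t - 2) * (real n - 2))"
    using t3 by (intro mult_left_mono) linarith+
  moreover have "(\<Sum>v\<in>M. d v) \<le> (2 * real t - 2) * (real n - 1)"
  proof -
    have "{v \<in> V. E u v} = M" using u irrefl by (auto simp: M_def)
    then have "(\<Sum>v\<in>M. Defs.degree M E v) \<le> (2 * t - 2) * card M"
      using nbr_degree_sum[OF u(1)] by simp
    then have "real (\<Sum>v\<in>M. Defs.degree M E v) \<le> real ((2 * t - 2) * (n - 1))"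
      using cM(1) by (simp only: of_nat_le_iff)
    then show ?thesis using cM(2) t_ge by (simp add: d_def of_nat_diff)
  qed
  ultimately have B: "real t * (\<Sum>v\<in>M. d v * y v) \<le> (real t - 1) * (real t * real n - 2 * real t + 2)"
    using A by (simp add: algebra_simps)
  \<comment> \<open>The quadratic rewritten is \<open>q (q - n) = 2 (t - 1) (q - t)\<close>. This
    makes the lower bound from \<open>scaled_subsolution\<close> comparable with \<open>B\<close>,
    and the two contradict each other for \<open>t \<ge> 3\<close>.\<close>
  have "q * (q - real n) \<le> mu * (mu - real n)"
    using mu mun q_gt t3 n_ge t_sq by (intro mult_mono) linarith+
  also have "q * (q - real n) = 2 * ((real t - 1) * (q - real t))"
    using q_root by (simp add: algebra_simps)
  finally have "(real t - 1) * (q - real t) \<le> (\<Sum>v\<in>M. d v * y v)" using y2 by linarith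
  then have "real t * ((real t - 1) * (q - real t)) \<le> real t * (\<Sum>v\<in>M. d v * y v)"
    using t3 by (intro mult_left_mono) linarith+
  then have "(real t - 1) * (real t * (q - real t)) \<le> (real t - 1) * (real t * real n - 2 * real t + 2)"
    using B by (simp add: mult_ac)
  then have C: "real t * (q - real t) \<le> real t * real n - 2 * real t + 2"
    using t3 by (subst (asm) mult_le_cancel_left_pos) linarith+
  have "real t * (real n + real t - 3) \<le> real t * (q - real t)"
    using q_gt t3 by (intro mult_left_mono) linarith+
  then have "(real t)\<^sup>2 - 3 * real t \<le> 2 - 2 * real t" using C by (simp add: algebra_simps power2_eq_square)
  then show False using t_sq t3 by linarith
qed

end

section \<open>Comparison with the Perron vector of the extremal graph\<close>

lemma (in sym_irrefl) alternating_path: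
  assumes M: "finite M" and "hs \<noteq> []" "distinct hs" "set hs \<subseteq> M" "set hs \<inter> X = {}" "finite X"
    and common: "\<And>h h'. h \<in> set hs \<Longrightarrow> h' \<in> set hs \<Longrightarrow> C \<le> card {l \<in> M. E h l \<and> E h' l}"
    and "card X + 2 * length hs \<le> C"
  shows "\<exists>p. gpath E M p \<and> length p = 2 * length hs \<and> hd p = hd hs \<and> set p \<inter> X = {}"
  using assms(2-)
proof (induction hs arbitrary: X)
  case (Cons h hs)
  have new: "\<exists>l. l \<in> M \<and> E h l \<and> E h' l \<and> l \<notin> Y"
    if "h' \<in> set (h # hs)" "finite Y" "card Y < C" for h' Y
  proof -
    have "card Y < card {l \<in> M. E h l \<and> E h' l}" using Cons.prems(6)[of h h'] that by simp
    then have "\<not> {l \<in> M. E h l \<and> E h' l} \<subseteq> Y" using that(2) by (meson card_mono linorder_not_le)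
    then show ?thesis by blast
  qed
  have cX: "card (insert h X) = Suc (card X)" using Cons.prems by simp
  show ?case
  proof (cases "hs = []")
    case True
    obtain l where l: "l \<in> M" "E h l" "l \<notin> insert h X"
      using new[of h "insert h X"] Cons.prems cX by auto
    have "gpath E M [h, l]" using l Cons.prems by (auto simp: gpath_def)
    then show ?thesis using True l Cons.prems by (intro exI[of _ "[h, l]"]) auto
  next
    case False
    have "\<exists>p. gpath E M p \<and> length p = 2 * length hs \<and> hd p = hd hs \<and> set p \<inter> insert h X = {}"
      using False Cons.prems cX by (intro Cons.IH) auto
    then obtain p where p: "gpath E M p" "length p = 2 * length hs" "hd p = hd hs" "set p \<inter> insert h X = {}"
      by blast
    have "card (insert h X \<union> set p) \<le> Suc (card X) + 2 * length hs"
      using card_Un_le[of "insert h X" "set p"] cX card_length[of p] p(2) by linarith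
    also have "\<dots> < C" using Cons.prems(7) by simp
    finally obtain l where l: "l \<in> M" "E h l" "E (hd hs) l" "l \<notin> insert h X \<union> set p"
      using new[of "hd hs" "insert h X \<union> set p"] Cons.prems(5) False by auto
    have ne: "p \<noteq> []" using p(2) False by auto
    have "gpath E M (h # l # p)"
      using p l ne sym[OF l(3)] Cons.prems unfolding gpath_def by (auto simp: successively_Cons)
    then show ?thesis using p l Cons.prems by (intro exI[of _ "h # l # p"]) auto
  qed
qed simp

context petal_free
begin

text \<open>Otherwise \<open>x\<close>, \<open>y\<close> and an alternating path through the
  \<open>t - 1\<close> hubs that starts at \<open>h\<close> form a path on \<open>2 * t\<close>
  vertices, all adjacent to \<open>u\<close>, against \<open>no_nbr_path\<close>.\<close>

lemma hub_edge_excluded: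
  assumes u: "u \<in> V" "\<forall>v\<in>V - {u}. E u v"
    and H: "H \<subseteq> V - {u}" "card H = t - 1"
    and hub: "\<And>h. h \<in> H \<Longrightarrow> n + 2 * t \<le> Defs.degree (V - {u}) E h + 2 * t\<^sup>2 + 1"
    and xy: "x \<in> V - insert u H" "y \<in> V - insert u H" "E x y" and h: "h \<in> H"
  shows "\<not> E y h"
proof
  assume yh: "E y h"
  define M where "M = V - {u}"
  have finM: "finite M" using fin by (simp add: M_def)
  have cM: "card M + 1 = n" using card_Suc_Diff1[OF fin u(1)] card_V by (simp add: M_def)
  have finH: "finite H" using H(1) finM finite_subset M_def by blast
  obtain hs' where hs': "set hs' = H - {h}" "distinct hs'"
    using finite_distinct_list finH by (metis finite_Diff)
  define hs where "hs = h # hs'"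
  have hs: "set hs = H" "distinct hs" "hd hs = h" using hs' h by (auto simp: hs_def)
  have lhs: "length hs = t - 1" using distinct_card[OF hs(2)] hs(1) H(2) by simp
  \<comment> \<open>Two hubs together miss at most \<open>4t(t - 1)\<close> of the
    \<open>n - 1\<close> vertices of \<open>M\<close>, leaving at least \<open>2t\<close> in common.
    \<open>alternating_path\<close> asks for \<open>2t\<close>: two for \<open>x\<close> and
    \<open>y\<close>, and \<open>2 (t - 1)\<close> for the path.\<close>
  have common: "2 * t \<le> card {l \<in> M. E h1 l \<and> E h2 l}" if "h1 \<in> set hs" "h2 \<in> set hs" for h1 h2
  proof -
    have "card {l \<in> M. E h1 l} + card {l \<in> M. E h2 l}
      = card ({l \<in> M. E h1 l} \<union> {l \<in> M. E h2 l}) + card ({l \<in> M. E h1 l} \<inter> {l \<in> M. E h2 l})"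
      using finM by (intro card_Un_Int) auto
    moreover have "{l \<in> M. E h1 l} \<inter> {l \<in> M. E h2 l} = {l \<in> M. E h1 l \<and> E h2 l}" by auto
    moreover have "card ({l \<in> M. E h1 l} \<union> {l \<in> M. E h2 l}) \<le> card M"
      using finM by (intro card_mono) auto
    ultimately have "card {l \<in> M. E h1 l} + card {l \<in> M. E h2 l} \<le> card M + card {l \<in> M. E h1 l \<and> E h2 l}"
      by simp
    moreover have "n + 2 * t \<le> card {l \<in> M. E h1 l} + 2 * t\<^sup>2 + 1"
      "n + 2 * t \<le> card {l \<in> M. E h2 l} + 2 * t\<^sup>2 + 1"
      using hub that hs(1) by (auto simp: Defs.degree_def M_def)
    moreover have "3 * t \<le> t\<^sup>2" using t_ge by (simp add: power2_eq_square)
    ultimately show ?thesis using n cM by linarith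
  qed
  have "\<exists>p. gpath E M p \<and> length p = 2 * length hs \<and> hd p = hd hs \<and> set p \<inter> {x, y} = {}"
  proof (rule alternating_path[OF finM _ hs(2) _ _ _ common])
    show "hs \<noteq> []" by (simp add: hs_def)
    show "set hs \<subseteq> M" using hs H by (simp add: M_def)
    show "set hs \<inter> {x, y} = {}" using hs xy by auto
    have "card {x, y} \<le> 2" by (simp add: card_insert_if)
    then show "card {x, y} + 2 * length hs \<le> 2 * t" using lhs t_ge by linarith
  qed simp_all
  then obtain p where p: "gpath E M p" "length p = 2 * (t - 1)" "hd p = h" "set p \<inter> {x, y} = {}"
    using hs lhs by auto
  have "x \<noteq> y" using xy irrefl by auto
  then have r: "gpath E M (x # y # p)"
    using p xy yh unfolding gpath_def M_def by (auto simp: successively_Cons)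
  then have "gpath E V (x # y # p)" "\<forall>v\<in>set (x # y # p). E u v"
    using u(2) unfolding gpath_def M_def by auto
  then have "length (x # y # p) < 2 * t" using no_nbr_path[OF u(1)] by blast
  then show False using p(2) t_ge by simp
qed

lemma bij_betw_matching_core:
  assumes "L \<subseteq> V" "card L = t"
  obtains f where "bij_betw f V {0..<n}" "\<And>v. v \<in> V \<Longrightarrow> f v < t \<longleftrightarrow> v \<in> L"
proof -
  have finL: "finite L" using assms(1) fin finite_subset by blast
  have tn: "t \<le> n" using assms card_mono[OF fin] card_V by auto
  obtain f1 where f1: "bij_betw f1 L {0..<t}"
    using finite_same_card_bij[of L "{0..<t}"] finL assms by auto
  have "card (V - L) = n - t" using assms fin card_V finL by (simp add: card_Diff_subset)
  then obtain f2 where f2: "bij_betw f2 (V - L) {t..<n}"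
    using finite_same_card_bij[of "V - L" "{t..<n}"] fin by auto
  define f where "f = (\<lambda>v. if v \<in> L then f1 v else f2 v)"
  have g1: "bij_betw f L {0..<t}" using f1 bij_betw_cong[of L f f1] by (simp add: f_def)
  have g2: "bij_betw f (V - L) {t..<n}" using f2 bij_betw_cong[of "V - L" f f2] by (simp add: f_def)
  have "bij_betw f (L \<union> (V - L)) ({0..<t} \<union> {t..<n})"
    by (rule bij_betw_combine[OF g1 g2]) auto
  moreover have "L \<union> (V - L) = V" "{0..<t} \<union> {t..<n} = {0..<n}" using assms(1) tn by auto
  moreover have "f v < t \<longleftrightarrow> v \<in> L" if "v \<in> V" for v
    using bij_betw_apply[OF g1, of v] bij_betw_apply[OF g2, of v] that by force
  ultimately show ?thesis using that by metis
qed

lemma iso_of_large_index: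
  assumes z: "\<And>v. 0 \<le> z v" "\<exists>v\<in>V. 0 < z v"
    and zQ: "\<And>v. v \<in> V \<Longrightarrow> mu * z v \<le> signless_lap_apply V E z v" and mu: "q \<le> mu"
  shows "graph_iso V E {0..<n} (S_edge t)"
proof -
  obtain u where u: "u \<in> V" "\<forall>v\<in>V - {u}. E u v" and mu2: "mu \<le> real n + 2 * real t - 2"
    using dominating_vertex[OF z zQ mu] by blast
  obtain H where H: "H \<subseteq> {v \<in> V - {u}. n + 2 * t \<le> Defs.degree (V - {u}) E v + 2 * t\<^sup>2 + 1}"
    and cH: "card H = t - 1"
    using many_hubs[OF u z zQ mu mu2] by (meson obtain_subset_with_card_n)
  have HV: "H \<subseteq> V - {u}" and hub: "\<And>h. h \<in> H \<Longrightarrow> n + 2 * t \<le> Defs.degree (V - {u}) E h + 2 * t\<^sup>2 + 1"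
    using H by blast+
  note excl = hub_edge_excluded[OF u HV cH hub]
  define L where "L = insert u H"
  have finH: "finite H" using HV fin finite_subset by blast
  have LV: "L \<subseteq> V" using HV u(1) by (auto simp: L_def)
  have "u \<notin> H" using HV by blast
  then have cL: "card L = t" using finH cH t_ge by (simp add: L_def)
  have finL: "finite L" using finH by (simp add: L_def)
  have cR: "card (V - L) = n - t" using LV cL fin finL card_V by (simp add: card_Diff_subset)
  have tn: "t \<le> n" using card_mono[OF fin LV] cL card_V by simp
  have t3: "3 \<le> real t" using t_ge by simp
  have qt: "real t < q" using q_big t_sq t3 by linarith
  \<comment> \<open>In the extremal graph, with value 1 on the clique, a vertex off the clique has
    row equation \<open>q \<beta> = t (1 + \<beta>)\<close>, which determines
    \<open>\<beta>\<close>; \<open>q1\<close> is then the row of a clique vertex.\<close>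
  define \<beta> where "\<beta> = real t / (q - real t)"
  have \<beta>0: "0 < \<beta>" using qt t3 by (simp add: \<beta>_def)
  have q\<beta>: "q * \<beta> = real t * (1 + \<beta>)" using qt by (simp add: \<beta>_def field_simps)
  have q1: "q = 2 * (real t - 1) + (real n - real t) * (1 + \<beta>)"
  proof -
    have "(q - (real n + real t - 2)) * (q - real t) = (real n - real t) * real t"
      using q_root by (simp add: algebra_simps)
    then have "q - (real n + real t - 2) = (real n - real t) * \<beta>"
      using qt by (simp add: \<beta>_def eq_divide_eq)
    then show ?thesis by (simp add: algebra_simps)
  qed
  define y where "y = (\<lambda>w. if w \<in> L then 1 else \<beta>)"
  define l r where "l = (\<lambda>v. real (Defs.degree L E v))" and "r = (\<lambda>v. real (Defs.degree (V - L) E v))"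
  have Qy: "signless_lap_apply V E y v = (l v + r v) * y v + l v + r v * \<beta>" if "v \<in> V" for v
    unfolding y_def l_def r_def using two_valued_apply[OF fin LV that] .
  have y0: "0 < y v" for v using \<beta>0 by (simp add: y_def)
  have lL: "l v \<le> real t - 1" if "v \<in> L" for v
    using degree_less_card[OF finL that] cL t_ge unfolding l_def by linarith
  have l0: "l v \<le> real t" for v using degree_le_card[OF finL] cL by (simp add: l_def)
  have r0: "r v \<le> real n - real t" for v
    using degree_le_card[of "V - L" v] fin cR tn by (simp add: r_def)
  have onL: "signless_lap_apply V E y v = 2 * l v + r v * (1 + \<beta>)" if "v \<in> L" for v
    using Qy that LV by (auto simp: y_def algebra_simps)
  have onR: "signless_lap_apply V E y v = l v * (1 + \<beta>) + 2 * r v * \<beta>" if "v \<in> V - L" for v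
    using Qy that by (auto simp: y_def algebra_simps)
  \<comment> \<open>A neighbour off \<open>L\<close> keeps \<open>v\<close> away from all hubs, so
    \<open>l v \<le> 1\<close>. Moreover no neighbour of \<open>v\<close> off \<open>L\<close> is
    adjacent to a hub, and a hub misses few vertices, which limits \<open>r v\<close> to
    \<open>2t(t - 1)\<close>.\<close>
  have Rstrict: "signless_lap_apply V E y v < q * y v" if v: "v \<in> V - L" "r v \<noteq> 0" for v
  proof -
    have "{w \<in> V - L. E v w} \<noteq> {}" using v(2) unfolding r_def Defs.degree_def by (metis card.empty of_nat_0)
    then obtain w where w: "w \<in> V - L" "E v w" by blast
    have noH: "\<not> E v h" if "h \<in> H" for h
      using excl[of w v h] w v(1) that sym unfolding L_def by blast
    have "{x \<in> L. E v x} \<subseteq> {u}" using noH by (auto simp: L_def)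
    then have "card {x \<in> L. E v x} \<le> card {u}" by (intro card_mono) simp_all
    then have l1: "l v \<le> 1" by (simp add: l_def Defs.degree_def)
    obtain h where h: "h \<in> H" using cH t_ge by (metis card.empty diff_is_0_eq ex_in_conv le_trans numeral_le_one_iff semiring_norm(70))
    let ?A = "{x \<in> V - L. E v x}" and ?B = "{x \<in> V - {u}. E h x}"
    have "?A \<inter> ?B = {}"
    proof -
      have "\<not> E h x" if "x \<in> ?A" for x
        using excl[of v x h] v(1) that h sym unfolding L_def by blast
      then show ?thesis by blast
    qed
    then have "card ?A + card ?B = card (?A \<union> ?B)" using fin by (subst card_Un_disjoint) auto
    also have "\<dots> \<le> card (V - {u})" using fin by (intro card_mono) (auto simp: L_def)
    also have "\<dots> = n - 1" using u(1) fin card_V by simp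
    finally have "Defs.degree (V - L) E v + Defs.degree (V - {u}) E h \<le> n - 1"
      by (simp add: Defs.degree_def)
    then have "Defs.degree (V - L) E v + 2 * t \<le> 2 * t\<^sup>2"
      using hub[OF h] tn t_ge by linarith
    then have "real (Defs.degree (V - L) E v + 2 * t) \<le> real (2 * t\<^sup>2)" by (simp only: of_nat_le_iff)
    then have rK: "r v \<le> 2 * real t * (real t - 1)" by (simp add: r_def algebra_simps power2_eq_square)
    have "2 * r v * \<beta> \<le> 2 * (2 * real t * (real t - 1)) * \<beta>"
      using rK \<beta>0 by (intro mult_right_mono) simp_all
    also have "\<dots> = (real t - 1) * (4 * real t * \<beta>)" by (simp add: algebra_simps)
    also have "\<dots> < (real t - 1) * (1 + \<beta>)"
    proof -
      \<comment> \<open>Multiplied by \<open>q - t\<close>, the wanted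
        \<open>4 t \<beta> < 1 + \<beta>\<close> reads \<open>4t^2 < q\<close>, since
        \<open>(q - t) \<beta> = t\<close>.\<close>
      have "4 * (real t)\<^sup>2 - real t < q - real t" using q_big t_sq t3 by linarith
      then have "4 * (real t * real t) < (q - real t) + real t" by (simp add: power2_eq_square)
      moreover have p\<beta>: "(q - real t) * \<beta> = real t" using qt by (simp add: \<beta>_def)
      have "(q - real t) * (4 * real t * \<beta>) = 4 * (real t * real t)"
        using p\<beta> by (metis mult.assoc mult.left_commute)
      moreover have "(q - real t) * (1 + \<beta>) = (q - real t) + real t" using p\<beta> by (simp only: distrib_left mult_1_right)
      ultimately have "(q - real t) * (4 * real t * \<beta>) < (q - real t) * (1 + \<beta>)" by linarith
      then have "4 * real t * \<beta> < 1 + \<beta>" using qt by (simp only: mult_less_cancel_left_pos diff_gt_0_iff_gt)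
      then show ?thesis using t3 by (intro mult_strict_left_mono) simp_all
    qed
    finally have "2 * r v * \<beta> < (real t - 1) * (1 + \<beta>)" .
    moreover have "l v * (1 + \<beta>) \<le> 1 * (1 + \<beta>)" using l1 \<beta>0 by (intro mult_right_mono) simp_all
    ultimately have "signless_lap_apply V E y v < real t * (1 + \<beta>)"
      unfolding onR[OF v(1)] by (simp add: algebra_simps)
    then show ?thesis using q\<beta> v(1) by (simp add: y_def)
  qed
  have yQ: "signless_lap_apply V E y v \<le> q * y v" if v: "v \<in> V" for v
  proof (cases "v \<in> L")
    case True
    have "r v * (1 + \<beta>) \<le> (real n - real t) * (1 + \<beta>)" using r0 \<beta>0 by (intro mult_right_mono) simp_all
    then have "signless_lap_apply V E y v \<le> q"
      using lL[OF True] unfolding onL[OF True] by (subst q1) (intro add_mono mult_left_mono, simp_all)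
    then show ?thesis using True by (simp add: y_def)
  next
    case False
    show ?thesis
    proof (cases "r v = 0")
      case True
      have "l v * (1 + \<beta>) \<le> real t * (1 + \<beta>)" using l0 \<beta>0 by (intro mult_right_mono) simp_all
      then show ?thesis using onR[of v] v False True q\<beta> by (simp add: y_def)
    qed (use Rstrict v False in force)
  qed
  note cb = collatz_bound[OF fin z zQ y0 yQ]
  have eq: "mu = q" using cb(1) mu by (simp add: order_antisym)
  have Qz: "signless_lap_apply V E z v = q * z v" if "v \<in> V" for v
    using eq that by (intro cb(2)) simp_all
  \<comment> \<open>\<open>z\<close> is now an exact eigenvector, so positivity spreads along edges;
    two steps through the dominating vertex \<open>u\<close> reach every vertex.\<close>
  have zpos: "0 < z v" if "v \<in> V" for v
  proof -
    have edge_pos: "0 < z w" if "w \<in> V" "x \<in> V" "E w x" "0 < z x" for w x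
    proof -
      have "0 < (\<Sum>u\<in>V. if E w u then z u else 0)"
        by (rule sum_pos2[OF fin that(2)]) (use that z in auto)
      then have "0 < signless_lap_apply V E z w"
        unfolding signless_lap_apply_def using z(1)[of w] by (simp add: add_nonneg_pos)
      then have "0 < q * z w" using Qz[OF that(1)] by simp
      then show ?thesis using z(1)[of w] by (metis less_eq_real_def mult_zero_right order_less_irrefl)
    qed
    obtain v0 where v0: "v0 \<in> V" "0 < z v0" using z(2) by blast
    have "0 < z u" using edge_pos[of u v0] u v0 by (cases "v0 = u") auto
    then show ?thesis using edge_pos[of v u] u that sym by (cases "v = u") auto
  qed
  have yeq: "signless_lap_apply V E y v = q * y v" if "v \<in> V" for v
    using eq that zpos[OF that] by (intro cb(3)) simp_all
  have adjL: "E v w" if v: "v \<in> L" and w: "w \<in> V" "w \<noteq> v" for v w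
  proof -
    have e: "2 * l v + r v * (1 + \<beta>) = 2 * (real t - 1) + (real n - real t) * (1 + \<beta>)"
      using yeq[of v] onL[OF v] v LV q1 by (auto simp: y_def)
    \<comment> \<open>Both terms are at most their values in the extremal graph and the sums agree,
      so each is attained: \<open>v\<close> has full degree inside and outside
      \<open>L\<close>.\<close>
    have "r v * (1 + \<beta>) \<le> (real n - real t) * (1 + \<beta>)" using r0 \<beta>0 by (intro mult_right_mono) simp_all
    moreover define X Y where "X = r v * (1 + \<beta>)" and "Y = (real n - real t) * (1 + \<beta>)"
    ultimately have "X \<le> Y" "2 * l v + X = 2 * (real t - 1) + Y" using e by simp_all
    moreover from this have "2 * l v + X = 2 * real t - 2 + Y" by simp
    moreover from calculation have "l v = real t - 1" using lL[OF v] by (smt (verit))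
    ultimately have "l v = real t - 1" "X = Y" by simp_all
    then have "l v = real t - 1" "r v * (1 + \<beta>) = (real n - real t) * (1 + \<beta>)"
      by (simp_all add: X_def Y_def)
    then have lr: "l v = real t - 1" "r v = real n - real t" using \<beta>0 by simp_all
    have "{x \<in> L. E v x} = L - {v}"
    proof (rule card_subset_eq)
      show "{x \<in> L. E v x} \<subseteq> L - {v}" using irrefl by auto
      show "card {x \<in> L. E v x} = card (L - {v})"
        using lr(1) cL v finL t_ge by (simp add: l_def Defs.degree_def)
    qed (use finL in simp)
    moreover have "{x \<in> V - L. E v x} = V - L"
    proof (rule card_subset_eq)
      show "card {x \<in> V - L. E v x} = card (V - L)"
        using lr(2) cR tn by (simp add: r_def Defs.degree_def)
    qed (use fin in auto)
    ultimately show ?thesis using w by blast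
  qed
  have nadjR: "\<not> E v w" if "v \<in> V - L" "w \<in> V - L" for v w
  proof -
    have "r v = 0" using Rstrict[OF that(1)] yeq[of v] that(1) by force
    then have "{x \<in> V - L. E v x} = {}" using fin by (simp add: r_def Defs.degree_def)
    then show ?thesis using that(2) by blast
  qed
  obtain f where f: "bij_betw f V {0..<n}" and fL: "\<And>v. v \<in> V \<Longrightarrow> f v < t \<longleftrightarrow> v \<in> L"
    using bij_betw_matching_core[OF LV cL] by blast
  have "E v w \<longleftrightarrow> S_edge t (f v) (f w)" if "v \<in> V" "w \<in> V" for v w
  proof -
    have "f v = f w \<longleftrightarrow> v = w" using f that by (auto simp: bij_betw_def inj_on_def)
    moreover have "E v w \<longleftrightarrow> v \<noteq> w \<and> (v \<in> L \<or> w \<in> L)"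
      using adjL[of v w] adjL[of w v] nadjR[of v w] that irrefl sym by blast
    ultimately show ?thesis using fL that by (simp add: S_edge_def)
  qed
  then show ?thesis using f unfolding graph_iso_def by blast
qed

end

section \<open>The index of the extremal graph\<close>

lemma exists_index_root:
  fixes n t :: real
  assumes "2 * t * (t - 1) + 1 < n + 2 * t - 2" "1 \<le> t"
  obtains q where "q * q = (n + 2 * t - 2) * q - 2 * t * (t - 1)" "n + 2 * t - 3 < q"
proof -
  define N where "N = n + 2 * t - 2"
  define s where "s = sqrt (N * N - 8 * t * (t - 1))"
  \<comment> \<open>The first assumption says that the discriminant exceeds
    \<open>(N - 2)^2\<close>, which pushes the larger root above \<open>N - 1\<close>.\<close>
  have less: "(N - 2) * (N - 2) < N * N - 8 * t * (t - 1)"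
    using assms(1) by (simp add: N_def algebra_simps)
  have "0 \<le> N * N - 8 * t * (t - 1)" using less zero_le_square[of "N - 2"] by linarith
  then have ss: "s * s = N * N - 8 * t * (t - 1)" by (simp add: s_def)
  have "0 \<le> 2 * t * (t - 1)" using assms(2) by simp
  then have N1: "1 < N" using assms(1) by (simp add: N_def)
  have "N - 2 < s"
    unfolding s_def using less by (intro real_less_rsqrt) (simp add: power2_eq_square)
  then have "n + 2 * t - 3 < (N + s) / 2" by (simp add: N_def)
  moreover have "(N + s) / 2 * ((N + s) / 2) = N * ((N + s) / 2) - 2 * t * (t - 1)"
    using ss by (simp add: field_simps)
  ultimately show ?thesis using that unfolding N_def by blast
qed

lemma sym_irrefl_S_edge: "sym_irrefl (S_edge t)"
  by unfold_locales (auto simp: S_edge_def)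

text \<open>The positive two-valued vector is an eigenvector for \<open>q\<close>; comparing it by
  \<open>collatz_bound\<close> with the absolute values of any eigenvector shows that no eigenvalue
  is larger.\<close>

lemma q_index_S:
  assumes t: "1 \<le> t" "t \<le> n" and q: "q * q = (real n + 2 * real t - 2) * q - 2 * real t * (real t - 1)" "real t < q"
  shows "q_index {0..<n} (S_edge t) = q"
proof -
  interpret S: sym_irrefl "S_edge t" by (rule sym_irrefl_S_edge)
  define \<beta> where "\<beta> = real t / (q - real t)"
  define y where "y = (\<lambda>w. if w \<in> {0..<t} then 1 else \<beta>)"
  have \<beta>0: "0 < \<beta>" using q t by (simp add: \<beta>_def)
  have q\<beta>: "q * \<beta> = real t * (1 + \<beta>)" using q(2) by (simp add: \<beta>_def field_simps)
  have q1: "q = 2 * (real t - 1) + (real n - real t) * (1 + \<beta>)"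
  proof -
    have "(q - (real n + real t - 2)) * (q - real t) = (real n - real t) * real t"
      using q(1) by (simp add: algebra_simps)
    then have "q - (real n + real t - 2) = (real n - real t) * \<beta>"
      using q(2) by (simp add: \<beta>_def eq_divide_eq)
    then show ?thesis by (simp add: algebra_simps)
  qed
  have yQ: "signless_lap_apply {0..<n} (S_edge t) y v = q * y v" if v: "v \<in> {0..<n}" for v
  proof -
    have a: "signless_lap_apply {0..<n} (S_edge t) y v =
      (real (Defs.degree {0..<t} (S_edge t) v) + real (Defs.degree ({0..<n} - {0..<t}) (S_edge t) v)) * y v +
      real (Defs.degree {0..<t} (S_edge t) v) + real (Defs.degree ({0..<n} - {0..<t}) (S_edge t) v) * \<beta>"
      unfolding y_def using t v by (intro S.two_valued_apply) auto
    have R: "{0..<n} - {0..<t} = {t..<n}" using t by auto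
    show ?thesis
    proof (cases "v < t")
      case True
      have "{u \<in> {0..<t}. S_edge t v u} = {0..<t} - {v}" "{u \<in> {t..<n}. S_edge t v u} = {t..<n}"
        using True by (auto simp: S_edge_def)
      then have "signless_lap_apply {0..<n} (S_edge t) y v =
        2 * (real t - 1) + (real n - real t) * (1 + \<beta>)"
        using a t True by (simp add: R Defs.degree_def y_def of_nat_diff algebra_simps)
      then show ?thesis using q1 True by (simp add: y_def)
    next
      case False
      have "{u \<in> {0..<t}. S_edge t v u} = {0..<t}" "{u \<in> {t..<n}. S_edge t v u} = {}"
        using False by (auto simp: S_edge_def)
      then show ?thesis using a q\<beta> False by (simp add: R Defs.degree_def y_def algebra_simps)
    qed
  qed
  have y0: "0 < y v" for v using \<beta>0 by (simp add: y_def)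
  have "0 \<in> {0..<n}" using t by simp
  then have "Q_eigenvalue {0..<n} (S_edge t) q"
    unfolding Q_eigenvalue_def using yQ y0 by (intro exI[of _ y]) (metis order_less_irrefl)
  moreover have "mu \<le> q" if mu: "Q_eigenvalue {0..<n} (S_edge t) mu" for mu
  proof -
    obtain z where "\<And>v. 0 \<le> z v" "\<exists>v\<in>{0..<n}. 0 < z v"
      "\<And>v. v \<in> {0..<n} \<Longrightarrow> mu * z v \<le> signless_lap_apply {0..<n} (S_edge t) z v"
      using S.nonneg_subsolution[OF mu] by blast
    from S.collatz_bound(1)[OF _ this, of y q] show ?thesis using yQ y0 by simp
  qed
  moreover have "finite {mu. Q_eigenvalue {0..<n} (S_edge t) mu}"
    using t by (intro S.Q_eigenvalues(1)) auto
  ultimately show ?thesis unfolding q_index_def by (intro Max_eqI) auto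
qed

theorem theorem1p7:
  fixes V :: "'a set" and E :: "'a \<Rightarrow> 'a \<Rightarrow> bool" and a :: "nat list" and n t :: nat
  assumes "length a \<ge> 2"
    and "\<forall>i j. i \<le> j \<and> j < length a \<longrightarrow> a ! j \<le> a ! i"
    and "\<forall>i < length a. a ! i \<ge> 1"
    and "a ! 0 \<ge> 2"
    and "t = sum_list a"
    and "simple_graph V E"
    and "card V = n"
    and "\<not> contains_subgraph V E (F_verts a) (F_edge a)"
    and "8 * t^2 + 9 \<le> n + 12 * t"
  shows "q_index V E \<le> q_index {0..<n} (S_edge t)
    \<and> (q_index V E = q_index {0..<n} (S_edge t) \<longleftrightarrow> graph_iso V E {0..<n} (S_edge t))"
proof -
  interpret sym_irrefl E
    using assms(6) by unfold_locales (auto simp: simple_graph_def)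
  \<comment> \<open>The list is non-increasing, so its head belongs to a longest cycle.\<close>
  obtain b a' where a: "a = b # a'" "a' \<noteq> []"
  proof
    show "a = hd a # tl a" "tl a \<noteq> []" using assms(1) by (cases a; force)+
  qed
  have a1: "\<forall>c\<in>set a. 1 \<le> c" using assms(3) by (metis in_set_conv_nth)
  have a': "\<forall>c\<in>set a'. 1 \<le> c \<and> c \<le> b"
  proof
    fix c assume "c \<in> set a'"
    then obtain i where i: "i < length a'" "c = a' ! i" by (metis in_set_conv_nth)
    then have "a ! Suc i \<le> a ! 0" using assms(2)[rule_format, of 0 "Suc i"] a by simp
    then show "1 \<le> c \<and> c \<le> b" using a1 \<open>c \<in> set a'\<close> i a by simp
  qed
  have b: "2 \<le> b" using assms(4) a by simp
  have t: "t = b + sum_list a'" using assms(5) a by simp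
  obtain c a'' where "a' = c # a''" using a(2) by (cases a') auto
  then have t3: "3 \<le> t" using a' b t by simp
  then have t_sq: "3 * real t \<le> (real t)\<^sup>2" by (simp add: power2_eq_square)
  \<comment> \<open>The order hypothesis avoids subtraction, which truncates on naturals; over the
    reals it becomes \<open>n \<ge> 8t^2 - 12t + 9\<close>.\<close>
  have "real (8 * t^2 + 9) \<le> real (n + 12 * t)" using assms(9) by (simp only: of_nat_le_iff)
  then have nr: "8 * (real t)\<^sup>2 - 12 * real t + 9 \<le> real n" by simp
  have "2 * real t * (real t - 1) = 2 * (real t)\<^sup>2 - 2 * real t"
    by (simp add: algebra_simps power2_eq_square)
  then have "2 * real t * (real t - 1) + 1 < real n + 2 * real t - 2" using nr t_sq t3 by linarith
  then obtain q where q: "q * q = (real n + 2 * real t - 2) * q - 2 * real t * (real t - 1)"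
    "real n + 2 * real t - 3 < q"
    using exists_index_root[of "real t" "real n"] t3 by auto
  have tn: "real t \<le> real n" using nr t_sq t3 by linarith
  have tq: "real t < q" using tn t3 q(2) by linarith
  have qS: "q_index {0..<n} (S_edge t) = q" using t3 tn tq q(1) by (intro q_index_S) simp_all
  have V: "finite V" "V \<noteq> {}" using assms(6,7) tn t3 by (auto simp: simple_graph_def)
  interpret petal_free E V b a' n t q
  proof unfold_locales
    show "\<not> petals E V u (b # a') ps" if "u \<in> V" for u ps
      using petals_contain_F[OF _ that, of a ps] a1 assms(8) a by blast
  qed (use V assms(6,7,9) a a' b t q in \<open>auto simp: simple_graph_def\<close>)
  \<comment> \<open>An index of at least \<open>q\<close> forces isomorphism and thereby the value
    \<open>q\<close>; this yields the inequality as well as the case of equality.\<close>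
  have iso: "graph_iso V E {0..<n} (S_edge t)" if "q \<le> q_index V E"
  proof -
    obtain z where "\<And>v. 0 \<le> z v" "\<exists>v\<in>V. 0 < z v"
      "\<And>v. v \<in> V \<Longrightarrow> q_index V E * z v \<le> signless_lap_apply V E z v"
      using nonneg_subsolution[OF q_index_eigenvalue[OF V]] by blast
    then show ?thesis using iso_of_large_index that by blast
  qed
  moreover have "q_index V E = q" if "graph_iso V E {0..<n} (S_edge t)"
    using graph_iso_q_index[OF that] qS by simp
  ultimately show ?thesis unfolding qS by (metis order_refl linorder_le_cases)
qed

end
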